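(* Let $L$ be a finite lattice and let $A$ be its incidence algebra over a field $K$. If $A$ is Auslander-Gorenstein, then $L$ is distributive.
   Context: The incidence algebra $A$ of $L$ over $K$ has $K$-basis the pairs $(x,y)$ with $x\le y$ in $L$, with product $(x,y)(y',z)=(x,z)$ if $y=y'$ and $0$ otherwise. Modules are finitely generated right modules. A finite dimensional algebra $A$ is Iwanaga-Gorenstein if $\operatorname{idim} A_A=\operatorname{idim}{}_AA<\infty$. It satisfies the Auslander condition if for every $n\ge1$ there is an injective coresolution $0\to A_A\to I^0\to I^1\to\cdots$ with $\operatorname{pdim} I^i\le i$ for all $0\le i<n$. It is Auslander-Gorenstein if it is Iwanaga-Gorenstein and satisfies the Auslander condition. *)

theory Defs
  imports "HOL-Algebra.Module" "HOL-Library.Extended_Nat"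
begin

section \<open>Finitely generated right modules\<close>

text \<open>
  The library's locale for modules requires a commutative ring of scalars, so right modules over
  an arbitrary ring are introduced here on the library record. The scalar is still written on the
  left: \<open>a \<odot>\<^bsub>M\<^esub> x\<close> denotes the result \<open>x \<cdot> a\<close> of the right action of \<open>a\<close> on \<open>x\<close>; compare
  \<open>smult_assoc\<close>. The fields \<open>mult\<close> and \<open>one\<close> of the record play no role.
\<close>

locale right_module = R?: ring R + M?: abelian_group M
  for R :: "('r, 'x) ring_scheme" (structure) and M :: "('r, 'm) module" (structure) +
  assumes smult_closed [simp, intro]:
      "\<lbrakk>a \<in> carrier R; x \<in> carrier M\<rbrakk> \<Longrightarrow> a \<odot>\<^bsub>M\<^esub> x \<in> carrier M"
    and smult_l_distr:
      "\<lbrakk>a \<in> carrier R; b \<in> carrier R; x \<in> carrier M\<rbrakk> \<Longrightarrow>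
       (a \<oplus>\<^bsub>R\<^esub> b) \<odot>\<^bsub>M\<^esub> x = a \<odot>\<^bsub>M\<^esub> x \<oplus>\<^bsub>M\<^esub> b \<odot>\<^bsub>M\<^esub> x"
    and smult_r_distr:
      "\<lbrakk>a \<in> carrier R; x \<in> carrier M; y \<in> carrier M\<rbrakk> \<Longrightarrow>
       a \<odot>\<^bsub>M\<^esub> (x \<oplus>\<^bsub>M\<^esub> y) = a \<odot>\<^bsub>M\<^esub> x \<oplus>\<^bsub>M\<^esub> a \<odot>\<^bsub>M\<^esub> y"
    and smult_assoc:
      "\<lbrakk>a \<in> carrier R; b \<in> carrier R; x \<in> carrier M\<rbrakk> \<Longrightarrow>
       (a \<otimes>\<^bsub>R\<^esub> b) \<odot>\<^bsub>M\<^esub> x = b \<odot>\<^bsub>M\<^esub> (a \<odot>\<^bsub>M\<^esub> x)"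
    and smult_one [simp]:
      "x \<in> carrier M \<Longrightarrow> \<one>\<^bsub>R\<^esub> \<odot>\<^bsub>M\<^esub> x = x"

definition finitely_generated :: "('r, 'x) ring_scheme \<Rightarrow> ('r, 'm) module \<Rightarrow> bool" where
  "finitely_generated R M \<longleftrightarrow>
     (\<exists>S. finite S \<and> S \<subseteq> carrier M \<and>
          (\<forall>x \<in> carrier M. \<exists>c \<in> S \<rightarrow> carrier R. x = (\<Oplus>\<^bsub>M\<^esub>s\<in>S. c s \<odot>\<^bsub>M\<^esub> s)))"

definition fg_module :: "('r, 'x) ring_scheme \<Rightarrow> ('r, 'm) module \<Rightarrow> bool" where
  "fg_module R M \<longleftrightarrow> right_module R M \<and> finitely_generated R M"

definition module_homs :: "('r, 'x) ring_scheme \<Rightarrow> ('r, 'm) module \<Rightarrow> ('r, 'n) module \<Rightarrow> ('m \<Rightarrow> 'n) set" where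
  "module_homs R M N =
     {f \<in> carrier M \<rightarrow> carrier N.
        (\<forall>x \<in> carrier M. \<forall>y \<in> carrier M. f (x \<oplus>\<^bsub>M\<^esub> y) = f x \<oplus>\<^bsub>N\<^esub> f y) \<and>
        (\<forall>a \<in> carrier R. \<forall>x \<in> carrier M. f (a \<odot>\<^bsub>M\<^esub> x) = a \<odot>\<^bsub>N\<^esub> f x)}"

definition module_kernel :: "('r, 'm) module \<Rightarrow> ('r, 'n) module \<Rightarrow> ('m \<Rightarrow> 'n) \<Rightarrow> 'm set" where
  "module_kernel M N f = {x \<in> carrier M. f x = \<zero>\<^bsub>N\<^esub>}"

text \<open>The right module \<open>R\<^sub>R\<close>.\<close>

definition regular_module :: "('r, 'x) ring_scheme \<Rightarrow> ('r, 'r) module" where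
  "regular_module R =
     \<lparr>carrier = carrier R, mult = mult R, one = one R, zero = zero R, add = add R,
      smult = (\<lambda>a x. x \<otimes>\<^bsub>R\<^esub> a)\<rparr>"

text \<open>Left modules over \<open>R\<close> are the right modules over the opposite ring of \<open>R\<close>.\<close>

definition opposite_ring :: "('r, 'x) ring_scheme \<Rightarrow> ('r, 'x) ring_scheme" where
  "opposite_ring R = R\<lparr>mult := (\<lambda>x y. y \<otimes>\<^bsub>R\<^esub> x)\<rparr>"


section \<open>A type for all finitely generated modules\<close>

text \<open>
  Statements about all finitely generated modules over a ring \<open>R\<close>, or about the existence of such
  modules, need a type in which their carriers live. An element of a module with \<open>n\<close> generators is
  given by \<open>n\<close> coefficients in \<open>R\<close>, so sequences in \<open>R\<close> suffice: this is
  \<open>fg_module_iso_fg_mod\<close> below.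
\<close>

type_synonym 'r fg_mod = "('r, nat \<Rightarrow> 'r) module"

theorem fg_module_iso_fg_mod:
  fixes R :: "('r, 'x) ring_scheme" and M :: "('r, 'm) module"
  assumes "fg_module R M"
  shows "\<exists>(N :: 'r fg_mod) h.
           fg_module R N \<and> h \<in> module_homs R M N \<and> bij_betw h (carrier M) (carrier N)"
proof -
  interpret right_module R M
    using assms by (simp add: fg_module_def)
  obtain S where S: "finite S" "S \<subseteq> carrier M"
    and gen: "\<forall>x \<in> carrier M. \<exists>c \<in> S \<rightarrow> carrier R. x = (\<Oplus>\<^bsub>M\<^esub>s\<in>S. c s \<odot>\<^bsub>M\<^esub> s)"
    using assms by (auto simp: fg_module_def finitely_generated_def)
  obtain c where c: "\<And>x. x \<in> carrier M \<Longrightarrow> c x \<in> S \<rightarrow> carrier R \<and> x = (\<Oplus>\<^bsub>M\<^esub>s\<in>S. c x s \<odot>\<^bsub>M\<^esub> s)"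
    using gen by metis
  obtain e :: "'m \<Rightarrow> nat" where e: "inj_on e S"
    using finite_imp_inj_to_nat_seg[OF S(1)] by blast
  define h where "h x = (\<lambda>i. c x (inv_into S e i))" for x
  have inj: "inj_on h (carrier M)"
  proof (rule inj_onI)
    fix x y assume xy: "x \<in> carrier M" "y \<in> carrier M" "h x = h y"
    have "c x s = c y s" if "s \<in> S" for s
      using fun_cong[OF xy(3), of "e s"] that e by (simp add: h_def)
    then have "(\<Oplus>\<^bsub>M\<^esub>s\<in>S. c x s \<odot>\<^bsub>M\<^esub> s) = (\<Oplus>\<^bsub>M\<^esub>s\<in>S. c y s \<odot>\<^bsub>M\<^esub> s)"
      using c[OF xy(2)] S by (intro M.finsum_cong') auto
    then show "x = y"
      using c[OF xy(1)] c[OF xy(2)] by simp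
  qed
  define g where "g = inv_into (carrier M) h"
  have gh [simp]: "g (h x) = x" if "x \<in> carrier M" for x
    using that inj by (simp add: g_def)
  define N :: "'r fg_mod" where
    "N = \<lparr>carrier = h ` carrier M, mult = undefined, one = undefined, zero = h \<zero>\<^bsub>M\<^esub>,
          add = (\<lambda>u v. h (g u \<oplus>\<^bsub>M\<^esub> g v)), smult = (\<lambda>a u. h (a \<odot>\<^bsub>M\<^esub> g u))\<rparr>"
  have N_simps [simp]: "carrier N = h ` carrier M" "zero N = h \<zero>\<^bsub>M\<^esub>"
    "add N u v = h (g u \<oplus>\<^bsub>M\<^esub> g v)" "smult N a u = h (a \<odot>\<^bsub>M\<^esub> g u)" for a u v
    by (simp_all add: N_def)
  have N_group: "abelian_group N"
  proof (rule abelian_groupI)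
    show "\<exists>y \<in> carrier N. y \<oplus>\<^bsub>N\<^esub> x = \<zero>\<^bsub>N\<^esub>" if xN: "x \<in> carrier N" for x
    proof -
      obtain z where z: "z \<in> carrier M" "x = h z"
        using xN by auto
      then have "h (\<ominus>\<^bsub>M\<^esub> z) \<in> carrier N" "h (\<ominus>\<^bsub>M\<^esub> z) \<oplus>\<^bsub>N\<^esub> x = \<zero>\<^bsub>N\<^esub>"
        by (auto simp: M.l_neg)
      then show ?thesis by blast
    qed
  qed (auto simp: M.a_ac)
  interpret N: abelian_group N by (rule N_group)
  have mod: "right_module R N"
  proof (intro right_module.intro right_module_axioms.intro N_group R.ring_axioms)
  qed (auto simp: smult_l_distr smult_r_distr smult_assoc)
  have sum: "h (\<Oplus>\<^bsub>M\<^esub>s\<in>T. f s) = (\<Oplus>\<^bsub>N\<^esub>s\<in>T. h (f s))"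
    if "finite T" "f \<in> T \<rightarrow> carrier M" for T :: "'m set" and f
    using that
  proof (induction T rule: finite_induct)
    case (insert s T)
    then have "h (\<Oplus>\<^bsub>M\<^esub>s\<in>T. f s) = (\<Oplus>\<^bsub>N\<^esub>s\<in>T. h (f s))" "f \<in> T \<rightarrow> carrier M" "f s \<in> carrier M"
      "(\<lambda>s. h (f s)) \<in> T \<rightarrow> carrier N"
      by auto
    moreover have "(\<Oplus>\<^bsub>M\<^esub>s\<in>T. f s) \<in> carrier M"
      using \<open>f \<in> T \<rightarrow> carrier M\<close> by (rule M.finsum_closed)
    moreover have "(\<Oplus>\<^bsub>M\<^esub>r\<in>insert s T. f r) = f s \<oplus>\<^bsub>M\<^esub> (\<Oplus>\<^bsub>M\<^esub>r\<in>T. f r)"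
      using insert.hyps calculation by (intro M.finsum_insert) auto
    moreover have "(\<Oplus>\<^bsub>N\<^esub>r\<in>insert s T. h (f r)) = h (f s) \<oplus>\<^bsub>N\<^esub> (\<Oplus>\<^bsub>N\<^esub>r\<in>T. h (f r))"
      using insert.hyps calculation by (intro N.finsum_insert) auto
    ultimately show ?case
      by (metis N_simps(3) gh)
  qed simp
  have "finitely_generated R N"
    unfolding finitely_generated_def
  proof (intro exI conjI ballI)
    show "finite (h ` S)" "h ` S \<subseteq> carrier N"
      using S by auto
    fix u assume "u \<in> carrier N"
    then obtain x where x: "x \<in> carrier M" "u = h x" by auto
    have injS: "inj_on h S"
      using inj S(2) by (rule inj_on_subset)
    have cS: "c x s \<in> carrier R" "s \<in> carrier M" if "s \<in> S" for s
      using c[OF x(1)] S that by auto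
    have "u = h (\<Oplus>\<^bsub>M\<^esub>s\<in>S. c x s \<odot>\<^bsub>M\<^esub> s)"
      using c[OF x(1)] x by simp
    also have "\<dots> = (\<Oplus>\<^bsub>N\<^esub>s\<in>S. h (c x s \<odot>\<^bsub>M\<^esub> s))"
      using S(1) cS by (intro sum) auto
    also have "\<dots> = (\<Oplus>\<^bsub>N\<^esub>s\<in>S. c x (g (h s)) \<odot>\<^bsub>N\<^esub> h s)"
      using cS by (intro N.finsum_cong') auto
    also have "\<dots> = (\<Oplus>\<^bsub>N\<^esub>v\<in>h ` S. c x (g v) \<odot>\<^bsub>N\<^esub> v)"
      using cS injS by (intro N.finsum_reindex[symmetric]) auto
    finally show "\<exists>c \<in> h ` S \<rightarrow> carrier R. u = (\<Oplus>\<^bsub>N\<^esub>v\<in>h ` S. c v \<odot>\<^bsub>N\<^esub> v)"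
      using cS by (intro bexI[of _ "\<lambda>v. c x (g v)"]) auto
  qed
  moreover have "h \<in> module_homs R M N"
    by (auto simp: module_homs_def)
  moreover have "bij_betw h (carrier M) (carrier N)"
    using inj by (simp add: bij_betw_def)
  ultimately show ?thesis
    using mod unfolding fg_module_def by blast
qed


section \<open>Projective and injective dimension\<close>

text \<open>Projectivity and injectivity refer to the category of finitely generated modules.\<close>

definition projective :: "('r, 'x) ring_scheme \<Rightarrow> ('r, 'p) module \<Rightarrow> bool" where
  "projective R P \<longleftrightarrow> fg_module R P \<and>
     (\<forall>(M :: 'r fg_mod) (N :: 'r fg_mod). fg_module R M \<longrightarrow> fg_module R N \<longrightarrow>
        (\<forall>g \<in> module_homs R M N. g ` carrier M = carrier N \<longrightarrow>
           (\<forall>f \<in> module_homs R P N. \<exists>k \<in> module_homs R P M. \<forall>x \<in> carrier P. g (k x) = f x)))"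

definition injective :: "('r, 'x) ring_scheme \<Rightarrow> ('r, 'i) module \<Rightarrow> bool" where
  "injective R I \<longleftrightarrow> fg_module R I \<and>
     (\<forall>(M :: 'r fg_mod) (N :: 'r fg_mod). fg_module R M \<longrightarrow> fg_module R N \<longrightarrow>
        (\<forall>g \<in> module_homs R M N. inj_on g (carrier M) \<longrightarrow>
           (\<forall>f \<in> module_homs R M I. \<exists>k \<in> module_homs R N I. \<forall>x \<in> carrier M. k (g x) = f x)))"

text \<open>\<open>\<cdots> \<rightarrow> P 2 \<rightarrow> P 1 \<rightarrow> P 0 \<rightarrow> M \<rightarrow> 0\<close> with differentials \<open>d i : P (i + 1) \<rightarrow> P i\<close>.\<close>

definition projective_resolution ::
    "('r, 'x) ring_scheme \<Rightarrow> ('r, 'm) module \<Rightarrow> (nat \<Rightarrow> 'r fg_mod) \<Rightarrow>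
     ((nat \<Rightarrow> 'r) \<Rightarrow> 'm) \<Rightarrow> (nat \<Rightarrow> (nat \<Rightarrow> 'r) \<Rightarrow> (nat \<Rightarrow> 'r)) \<Rightarrow> bool" where
  "projective_resolution R M P \<epsilon> d \<longleftrightarrow>
     (\<forall>i. projective R (P i)) \<and>
     \<epsilon> \<in> module_homs R (P 0) M \<and>
     (\<forall>i. d i \<in> module_homs R (P (Suc i)) (P i)) \<and>
     \<epsilon> ` carrier (P 0) = carrier M \<and>
     d 0 ` carrier (P 1) = module_kernel (P 0) M \<epsilon> \<and>
     (\<forall>i. d (Suc i) ` carrier (P (Suc (Suc i))) = module_kernel (P (Suc i)) (P i) (d i))"

text \<open>\<open>0 \<rightarrow> M \<rightarrow> I 0 \<rightarrow> I 1 \<rightarrow> I 2 \<rightarrow> \<cdots>\<close> with differentials \<open>d i : I i \<rightarrow> I (i + 1)\<close>.\<close>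

definition injective_coresolution ::
    "('r, 'x) ring_scheme \<Rightarrow> ('r, 'm) module \<Rightarrow> (nat \<Rightarrow> 'r fg_mod) \<Rightarrow>
     ('m \<Rightarrow> (nat \<Rightarrow> 'r)) \<Rightarrow> (nat \<Rightarrow> (nat \<Rightarrow> 'r) \<Rightarrow> (nat \<Rightarrow> 'r)) \<Rightarrow> bool" where
  "injective_coresolution R M I \<epsilon> d \<longleftrightarrow>
     (\<forall>i. injective R (I i)) \<and>
     \<epsilon> \<in> module_homs R M (I 0) \<and>
     (\<forall>i. d i \<in> module_homs R (I i) (I (Suc i))) \<and>
     inj_on \<epsilon> (carrier M) \<and>
     \<epsilon> ` carrier M = module_kernel (I 0) (I 1) (d 0) \<and>
     (\<forall>i. d i ` carrier (I i) = module_kernel (I (Suc i)) (I (Suc (Suc i))) (d (Suc i)))"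

text \<open>
  The infimum of the empty set is \<open>\<infinity>\<close>. The zero module has both dimensions \<open>0\<close>.
\<close>

definition pdim :: "('r, 'x) ring_scheme \<Rightarrow> ('r, 'm) module \<Rightarrow> enat" where
  "pdim R M = Inf {enat n | n. \<exists>P \<epsilon> d. projective_resolution R M P \<epsilon> d \<and>
                                 (\<forall>i>n. carrier (P i) = {\<zero>\<^bsub>P i\<^esub>})}"

definition idim :: "('r, 'x) ring_scheme \<Rightarrow> ('r, 'm) module \<Rightarrow> enat" where
  "idim R M = Inf {enat n | n. \<exists>I \<epsilon> d. injective_coresolution R M I \<epsilon> d \<and>
                                 (\<forall>i>n. carrier (I i) = {\<zero>\<^bsub>I i\<^esub>})}"


section \<open>Auslander-Gorenstein algebras\<close>

text \<open>
  These notions depend on the ring underlying a finite dimensional algebra only, so they are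
  phrased for rings.
\<close>

definition iwanaga_gorenstein :: "('r, 'x) ring_scheme \<Rightarrow> bool" where
  "iwanaga_gorenstein A \<longleftrightarrow>
     idim A (regular_module A) = idim (opposite_ring A) (regular_module (opposite_ring A)) \<and>
     idim A (regular_module A) < \<infinity>"

definition auslander_condition :: "('r, 'x) ring_scheme \<Rightarrow> bool" where
  "auslander_condition A \<longleftrightarrow>
     (\<forall>n\<ge>1. \<exists>I \<epsilon> d. injective_coresolution A (regular_module A) I \<epsilon> d \<and>
                       (\<forall>i<n. pdim A (I i) \<le> enat i))"

definition auslander_gorenstein :: "('r, 'x) ring_scheme \<Rightarrow> bool" where
  "auslander_gorenstein A \<longleftrightarrow> iwanaga_gorenstein A \<and> auslander_condition A"


section \<open>Incidence algebras\<close>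

text \<open>
  The incidence algebra of the finite poset \<open>'a\<close> over the field \<open>'k\<close>. The element
  \<open>\<Sum> f (x, y) (x, y)\<close>, the sum ranging over \<open>x \<le> y\<close>, is encoded as the function \<open>f\<close>,
  extended by \<open>0\<close> to the other pairs.
\<close>

definition incidence_algebra :: "('k::field, 'a::{finite,order} \<times> 'a \<Rightarrow> 'k) module" where
  "incidence_algebra =
     \<lparr>carrier = {f. \<forall>x y. \<not> x \<le> y \<longrightarrow> f (x, y) = 0},
      mult = (\<lambda>f g (x, z). \<Sum>y | x \<le> y \<and> y \<le> z. f (x, y) * g (y, z)),
      one = (\<lambda>(x, y). if x = y then 1 else 0),
      zero = (\<lambda>_. 0),
      add = (\<lambda>f g p. f p + g p),
      smult = (\<lambda>c f p. c * f p)\<rparr>"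

definition incidence_basis :: "'a::{finite,order} \<times> 'a \<Rightarrow> ('a \<times> 'a \<Rightarrow> 'k::field)" where
  "incidence_basis p = (\<lambda>q. if q = p then 1 else 0)"

lemma incidence_basis_mult:
  assumes "x \<le> y" "y' \<le> z"
  shows "(incidence_basis (x, y) :: 'a::{finite,order} \<times> 'a \<Rightarrow> 'k::field)
             \<otimes>\<^bsub>incidence_algebra\<^esub> incidence_basis (y', z) =
         (if y = y' then incidence_basis (x, z) else \<zero>\<^bsub>incidence_algebra :: ('k, 'a \<times> 'a \<Rightarrow> 'k) module\<^esub>)"
proof (rule ext)
  fix p :: "'a \<times> 'a"
  obtain u w where p: "p = (u, w)" by (cases p)
  have "(\<Sum>v | u \<le> v \<and> v \<le> w. incidence_basis (x, y) (u, v) * incidence_basis (y', z) (v, w))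
      = (\<Sum>v | u \<le> v \<and> v \<le> w. if v = y then (if u = x \<and> w = z \<and> y = y' then 1 else 0 :: 'k) else 0)"
    by (rule sum.cong) (auto simp: incidence_basis_def)
  also have "\<dots> = (if u = x \<and> w = z \<and> y = y' then 1 else 0)"
    using assms by (auto simp: sum.delta)
  finally show "((incidence_basis (x, y) :: 'a \<times> 'a \<Rightarrow> 'k)
             \<otimes>\<^bsub>incidence_algebra\<^esub> incidence_basis (y', z)) p =
         (if y = y' then incidence_basis (x, z) else \<zero>\<^bsub>incidence_algebra :: ('k, 'a \<times> 'a \<Rightarrow> 'k) module\<^esub>) p"
    by (auto simp: incidence_algebra_def p) (auto simp: incidence_basis_def)
qed

lemma incidence_algebra_expansion:
  fixes f :: "'a::{finite,order} \<times> 'a \<Rightarrow> 'k::field"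
  assumes "f \<in> carrier (incidence_algebra :: ('k, 'a \<times> 'a \<Rightarrow> 'k) module)"
  shows "f q = (\<Sum>(x, y) | x \<le> y. f (x, y) * incidence_basis (x, y) q)"
proof -
  have "(\<Sum>(x, y) | x \<le> y. f (x, y) * incidence_basis (x, y) q)
      = (\<Sum>p | fst p \<le> snd p. if p = q then f q else 0)"
    by (rule sum.cong) (auto simp: incidence_basis_def)
  also have "\<dots> = f q"
    using assms by (cases q) (auto simp: sum.delta incidence_algebra_def)
  finally show ?thesis ..
qed

lemma ring_incidence_algebra:
  "ring (incidence_algebra :: ('k::field, 'a::{finite,order} \<times> 'a \<Rightarrow> 'k) module)"
    (is "ring ?A")
proof (rule ringI)
  show "abelian_group ?A"
  proof (rule abelian_groupI)
    show "\<exists>y \<in> carrier ?A. y \<oplus>\<^bsub>?A\<^esub> f = \<zero>\<^bsub>?A\<^esub>" if "f \<in> carrier ?A" for f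
      using that by (intro bexI[of _ "\<lambda>p. - f p"]) (auto simp: incidence_algebra_def)
  qed (auto simp: incidence_algebra_def algebra_simps)
  show "monoid ?A"
  proof (rule monoidI)
    fix f g h :: "'a \<times> 'a \<Rightarrow> 'k"
    have "(\<Sum>y | x \<le> y \<and> y \<le> z. (\<Sum>u | x \<le> u \<and> u \<le> y. f (x, u) * g (u, y)) * h (y, z)) =
          (\<Sum>u | x \<le> u \<and> u \<le> z. f (x, u) * (\<Sum>y | u \<le> y \<and> y \<le> z. g (u, y) * h (y, z)))" for x z
      unfolding sum_distrib_left sum_distrib_right sum.Sigma[OF finite finite[THEN ballI]]
      by (rule sum.reindex_bij_witness[where i = "\<lambda>(u, y). (y, u)" and j = "\<lambda>(y, u). (u, y)"])
        (auto simp: mult.assoc)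
    then show "(f \<otimes>\<^bsub>?A\<^esub> g) \<otimes>\<^bsub>?A\<^esub> h = f \<otimes>\<^bsub>?A\<^esub> (g \<otimes>\<^bsub>?A\<^esub> h)"
      by (auto simp: incidence_algebra_def)
  next
    fix f :: "'a \<times> 'a \<Rightarrow> 'k" assume f: "f \<in> carrier ?A"
    have "(\<Sum>y | x \<le> y \<and> y \<le> z. (if x = y then 1 else 0) * f (y, z)) = f (x, z)"
      "(\<Sum>y | x \<le> y \<and> y \<le> z. f (x, y) * (if y = z then 1 else 0)) = f (x, z)" for x z
      using f by (auto simp: incidence_algebra_def if_distrib[of "\<lambda>c. c * _"]
          if_distrib[of "\<lambda>c. _ * c"] sum.delta sum.delta' cong: if_cong)
    then show "\<one>\<^bsub>?A\<^esub> \<otimes>\<^bsub>?A\<^esub> f = f" "f \<otimes>\<^bsub>?A\<^esub> \<one>\<^bsub>?A\<^esub> = f"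
      by (auto simp: incidence_algebra_def)
  next
    fix f g assume "f \<in> carrier ?A" "g \<in> carrier ?A"
    then show "f \<otimes>\<^bsub>?A\<^esub> g \<in> carrier ?A"
      by (auto simp: incidence_algebra_def intro!: sum.neutral dest: order_trans)
  qed (auto simp: incidence_algebra_def)
qed (auto simp: incidence_algebra_def fun_eq_iff algebra_simps sum.distrib)

end

theory Submission
  imports Defs
begin

text \<open>
  Only the terms \<open>I 0\<close> and \<open>I 1\<close> of a coresolution matter. Let \<open>y\<close> be meet-irreducible with upper
  cover \<open>y'\<close>. The extension \<open>e\<^sub>y A\<close> of the simple module \<open>S\<close> at \<open>y\<close> by \<open>e\<^sub>y\<^sub>' A\<close> puts \<open>S\<close> into the
  socle of \<open>I 1\<close>, and by injectivity the embedding of \<open>S\<close> extends to the module with support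
  \<open>{z. z \<le> y}\<close>; its generator maps to some \<open>g\<close> in \<open>I 1\<close>. Let \<open>0 \<rightarrow> P 1 \<rightarrow> P 0 \<rightarrow> I 1 \<rightarrow> 0\<close> be a
  projective resolution and lift \<open>g\<close> to \<open>q\<close> in \<open>P 0\<close>. If \<open>a\<close> and \<open>b\<close> are not below \<open>y\<close>, then the
  components of \<open>q\<close> at \<open>a\<close> and \<open>b\<close> lie in \<open>P 1\<close>. As \<open>P 1\<close> is projective, that is, a retract of a free
  module, they come from an element of \<open>P 1\<close> at \<open>inf a b\<close>, which is then the component of \<open>q\<close>
  there. So \<open>g\<close> vanishes at \<open>inf a b\<close>, and \<open>inf a b\<close> is not below \<open>y\<close>. Hence every
  meet-irreducible element is meet-prime, which characterises distributivity.
\<close>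

section \<open>Homomorphisms of right modules\<close>

lemma module_homs_closed:
  "f \<in> module_homs R M N \<Longrightarrow> x \<in> carrier M \<Longrightarrow> f x \<in> carrier N"
  by (auto simp: module_homs_def)

lemma module_homs_add:
  "f \<in> module_homs R M N \<Longrightarrow> x \<in> carrier M \<Longrightarrow> y \<in> carrier M \<Longrightarrow> f (x \<oplus>\<^bsub>M\<^esub> y) = f x \<oplus>\<^bsub>N\<^esub> f y"
  by (auto simp: module_homs_def)

lemma module_homs_smult:
  "f \<in> module_homs R M N \<Longrightarrow> a \<in> carrier R \<Longrightarrow> x \<in> carrier M \<Longrightarrow> f (a \<odot>\<^bsub>M\<^esub> x) = a \<odot>\<^bsub>N\<^esub> f x"
  by (auto simp: module_homs_def)

lemma module_homs_comp:
  "f \<in> module_homs R M N \<Longrightarrow> g \<in> module_homs R N P \<Longrightarrow> (\<lambda>x. g (f x)) \<in> module_homs R M P"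
  by (auto simp: module_homs_def Pi_iff)

lemma (in abelian_group) add_idem_imp_zero:
  assumes "x \<in> carrier G" "x \<oplus> x = x"
  shows "x = \<zero>"
  using assms by (metis add.l_cancel_one')

lemma module_homs_zero:
  assumes "abelian_group M" "abelian_group N" "f \<in> module_homs R M N"
  shows "f \<zero>\<^bsub>M\<^esub> = \<zero>\<^bsub>N\<^esub>"
proof -
  interpret M: abelian_group M by fact
  interpret N: abelian_group N by fact
  show ?thesis
    using module_homs_add[OF assms(3), of "\<zero>\<^bsub>M\<^esub>" "\<zero>\<^bsub>M\<^esub>"] module_homs_closed[OF assms(3)]
    by (intro N.add_idem_imp_zero) auto
qed

lemma (in right_module) smult_zero_right:
  assumes "a \<in> carrier R"
  shows "a \<odot>\<^bsub>M\<^esub> \<zero>\<^bsub>M\<^esub> = \<zero>\<^bsub>M\<^esub>"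
  using smult_r_distr[OF assms, of "\<zero>\<^bsub>M\<^esub>" "\<zero>\<^bsub>M\<^esub>"] assms
  by (intro M.add_idem_imp_zero) auto

section \<open>Transport to arbitrary carrier types, and resolutions of bounded length\<close>

lemma module_homs_inv_into:
  assumes "right_module R M" "h \<in> module_homs R M N" "bij_betw h (carrier M) (carrier N)"
  shows "inv_into (carrier M) h \<in> module_homs R N M"
proof -
  interpret right_module R M by fact
  have inj: "inj_on h (carrier M)" and img: "h ` carrier M = carrier N"
    using assms(3) by (auto simp: bij_betw_def)
  show ?thesis
    unfolding module_homs_def img[symmetric]
    using inj by (auto simp flip: module_homs_add[OF assms(2)] module_homs_smult[OF assms(2)])
qed

text \<open>\<open>injective\<close> quantifies over modules of type \<open>'r fg_mod\<close> only.
  Replacing \<open>M\<close> and \<open>N\<close> by their copies from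
  \<open>fg_module_iso_fg_mod\<close> makes the extension property available for interval modules,
  whose carriers live in another type.\<close>

lemma injective_extend:
  fixes M :: "('r, 'm) module" and N :: "('r, 'n) module"
  assumes I: "injective R I" and M: "fg_module R M" and N: "fg_module R N"
    and g: "g \<in> module_homs R M N" "inj_on g (carrier M)" and f: "f \<in> module_homs R M I"
  obtains k where "k \<in> module_homs R N I" "\<And>x. x \<in> carrier M \<Longrightarrow> k (g x) = f x"
proof -
  obtain M' :: "'r fg_mod" and h where M': "fg_module R M'" "h \<in> module_homs R M M'"
      "bij_betw h (carrier M) (carrier M')"
    using fg_module_iso_fg_mod[OF M] by blast
  obtain N' :: "'r fg_mod" and h' where N': "fg_module R N'" "h' \<in> module_homs R N N'"
      "bij_betw h' (carrier N) (carrier N')"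
    using fg_module_iso_fg_mod[OF N] by blast
  define j where "j = inv_into (carrier M) h"
  have j: "j \<in> module_homs R M' M"
    unfolding j_def using M M' by (intro module_homs_inv_into) (auto simp: fg_module_def)
  have jh: "j (h x) = x" if "x \<in> carrier M" for x
    using that M'(3) by (simp add: j_def bij_betw_def)
  have injj: "inj_on j (carrier M')"
    unfolding j_def using M'(3) by (simp add: bij_betw_def inj_on_inv_into)
  have "(\<lambda>x. h' (g (j x))) \<in> module_homs R M' N'"
    by (rule module_homs_comp[OF module_homs_comp[OF j g(1)] N'(2)])
  moreover have "inj_on (\<lambda>x. h' (g (j x))) (carrier M')"
    using injj g(2) bij_betw_imp_inj_on[OF N'(3)] module_homs_closed[OF j] module_homs_closed[OF g(1)]
    by (auto simp: inj_on_def)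
  moreover have "(\<lambda>x. f (j x)) \<in> module_homs R M' I"
    by (rule module_homs_comp[OF j f])
  ultimately obtain k where k: "k \<in> module_homs R N' I"
      "\<And>x. x \<in> carrier M' \<Longrightarrow> k (h' (g (j x))) = f (j x)"
    using I M'(1) N'(1) unfolding injective_def by metis
  show thesis
  proof
    show "(\<lambda>x. k (h' x)) \<in> module_homs R N I"
      by (rule module_homs_comp[OF N'(2) k(1)])
    show "k (h' (g x)) = f x" if "x \<in> carrier M" for x
      using k(2)[OF module_homs_closed[OF M'(2) that]] by (simp add: jh that)
  qed
qed

text \<open>\<open>enat\<close> is well-ordered, so the infimum of a nonempty set is attained, and a
  resolution that vanishes beyond the least possible \<open>m\<close> also vanishes beyond
  \<open>n\<close>.\<close>

lemma pdim_leD: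
  assumes "pdim R M \<le> enat n"
  obtains P \<epsilon> d where "projective_resolution R M P \<epsilon> d" "\<And>i. i > n \<Longrightarrow> carrier (P i) = {\<zero>\<^bsub>P i\<^esub>}"
proof -
  define S where "S = {enat n | n. \<exists>P \<epsilon> d. projective_resolution R M P \<epsilon> d \<and>
                                 (\<forall>i>n. carrier (P i) = {\<zero>\<^bsub>P i\<^esub>})}"
  have le: "Inf S \<le> enat n"
    using assms by (simp add: pdim_def S_def)
  \<comment> \<open>The infimum of the empty set is \<open>\<infinity>\<close>, which exceeds
    \<open>enat n\<close>.\<close>
  then have "S \<noteq> {}"
    by (auto simp: Inf_enat_def)
  then have "Inf S \<in> S"
    by (meson ex_in_conv wellorder_InfI)
  then obtain m P \<epsilon> d where "Inf S = enat m" "projective_resolution R M P \<epsilon> d"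
    "\<forall>i>m. carrier (P i) = {\<zero>\<^bsub>P i\<^esub>}"
    unfolding S_def by blast
  with le that show thesis by auto
qed


section \<open>Projective modules are retracts of free modules\<close>

text \<open>Extending vectors by zero from \<open>J\<close> to all of \<open>nat\<close> gives the
  module the type \<open>'r fg_mod\<close> and makes equality of elements equality of
  functions.\<close>

definition free_module :: "('r, 'x) ring_scheme \<Rightarrow> nat set \<Rightarrow> 'r fg_mod" where
  "free_module R J =
     \<lparr>carrier = {f. (\<forall>i\<in>J. f i \<in> carrier R) \<and> (\<forall>i. i \<notin> J \<longrightarrow> f i = \<zero>\<^bsub>R\<^esub>)},
      mult = undefined, one = undefined, zero = (\<lambda>_. \<zero>\<^bsub>R\<^esub>),
      add = (\<lambda>f g i. f i \<oplus>\<^bsub>R\<^esub> g i), smult = (\<lambda>a f i. f i \<otimes>\<^bsub>R\<^esub> a)\<rparr>"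

lemma free_module_simps [simp]:
  "zero (free_module R J) = (\<lambda>_. \<zero>\<^bsub>R\<^esub>)"
  "add (free_module R J) f g = (\<lambda>i. f i \<oplus>\<^bsub>R\<^esub> g i)"
  "smult (free_module R J) a f = (\<lambda>i. f i \<otimes>\<^bsub>R\<^esub> a)"
  by (simp_all add: free_module_def)

lemma carrier_free_module:
  assumes "ring R"
  shows "carrier (free_module R J) = {f. (\<forall>i. f i \<in> carrier R) \<and> (\<forall>i. i \<notin> J \<longrightarrow> f i = \<zero>\<^bsub>R\<^esub>)}"
proof -
  interpret ring R by fact
  show ?thesis
    unfolding free_module_def by (simp, intro Collect_cong) (metis zero_closed)
qed

lemma right_module_free_module:
  assumes "ring R"
  shows "right_module R (free_module R J)"
proof -
  interpret ring R by fact
  have "abelian_group (free_module R J)"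
  proof (rule abelian_groupI)
    show "\<exists>g \<in> carrier (free_module R J). g \<oplus>\<^bsub>free_module R J\<^esub> f = \<zero>\<^bsub>free_module R J\<^esub>"
      if "f \<in> carrier (free_module R J)" for f
      using that by (intro bexI[of _ "\<lambda>i. \<ominus>\<^bsub>R\<^esub> f i"]) (auto simp: carrier_free_module[OF assms] l_neg)
  qed (auto simp: carrier_free_module[OF assms] a_ac)
  then show ?thesis
    by (intro right_module.intro right_module_axioms.intro assms)
      (auto simp: carrier_free_module[OF assms] l_distr r_distr m_assoc)
qed

lemma finsum_free_module:
  assumes "ring R" "finite T" "g \<in> T \<rightarrow> carrier (free_module R J)"
  shows "(\<Oplus>\<^bsub>free_module R J\<^esub>j\<in>T. g j) i = (\<Oplus>\<^bsub>R\<^esub>j\<in>T. g j i)"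
proof -
  interpret right_module R "free_module R J"
    using assms(1) by (rule right_module_free_module)
  show ?thesis
    using assms(2,3)
  proof (induction T rule: finite_induct)
    case (insert j T)
    then have "(\<lambda>j. g j i) \<in> T \<rightarrow> carrier R" "g j i \<in> carrier R"
      by (auto simp: carrier_free_module[OF assms(1)] Pi_iff)
    with insert show ?case
      by (simp add: M.finsum_insert R.finsum_insert)
  qed simp
qed

lemma fg_module_free_module:
  assumes R: "ring R" and J: "finite J"
  shows "fg_module R (free_module R J)"
proof -
  let ?F = "free_module R J"
  interpret right_module R ?F
    using R by (rule right_module_free_module)
  have carrier: "f \<in> carrier ?F \<longleftrightarrow> (\<forall>i. f i \<in> carrier R) \<and> (\<forall>i. i \<notin> J \<longrightarrow> f i = \<zero>\<^bsub>R\<^esub>)" for f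
    by (simp add: carrier_free_module[OF R])
  have "finitely_generated R ?F"
  \<comment> \<open>Over the zero ring the unit vectors coincide and may fail to be indexed
    injectively by \<open>J\<close>; there the module is zero and the empty set generates
    it.\<close>
  proof (cases "\<one>\<^bsub>R\<^esub> = \<zero>\<^bsub>R\<^esub>")
    case True
    then have "carrier R = {\<zero>\<^bsub>R\<^esub>}"
      by (rule R.one_zeroD)
    then have "\<forall>f \<in> carrier ?F. f = \<zero>\<^bsub>?F\<^esub>"
      by (auto simp: carrier)
    then show ?thesis
      unfolding finitely_generated_def by (intro exI[of _ "{}"]) auto
  next
    case False
    define \<delta> :: "nat \<Rightarrow> nat \<Rightarrow> 'a" where "\<delta> j = (\<lambda>i. if j = i then \<one>\<^bsub>R\<^esub> else \<zero>\<^bsub>R\<^esub>)" for j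
    have inj: "inj_on \<delta> J"
      using False by (auto simp: inj_on_def \<delta>_def fun_eq_iff)
    have \<delta>: "\<delta> j \<in> carrier ?F" if "j \<in> J" for j
      using that by (auto simp: carrier \<delta>_def)
    show ?thesis
      unfolding finitely_generated_def
    proof (intro exI conjI ballI)
      show "finite (\<delta> ` J)" "\<delta> ` J \<subseteq> carrier ?F"
        using J \<delta> by auto
      fix f assume f: "f \<in> carrier ?F"
      \<comment> \<open>\<open>finitely_generated\<close> attaches coefficients to generators, not
        to indices, so the coordinates of \<open>f\<close> are read through the inverse of
        \<open>\<delta>\<close>.\<close>
      define c where "c v = f (inv_into J \<delta> v)" for v
      have c: "c (\<delta> j) = f j" if "j \<in> J" for j
        using that inj by (simp add: c_def)
      have cR: "c v \<in> carrier R" for v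
        using f by (simp add: c_def carrier)
      have sm: "(\<lambda>j. f j \<odot>\<^bsub>?F\<^esub> \<delta> j) \<in> J \<rightarrow> carrier ?F"
        using \<delta> f by (auto simp: carrier simp del: free_module_simps)
      have "f i = (\<Oplus>\<^bsub>?F\<^esub>j\<in>J. f j \<odot>\<^bsub>?F\<^esub> \<delta> j) i" for i
      proof -
        have "(\<Oplus>\<^bsub>?F\<^esub>j\<in>J. f j \<odot>\<^bsub>?F\<^esub> \<delta> j) i = (\<Oplus>\<^bsub>R\<^esub>j\<in>J. (f j \<odot>\<^bsub>?F\<^esub> \<delta> j) i)"
          by (rule finsum_free_module[OF R J sm])
        also have "\<dots> = (\<Oplus>\<^bsub>R\<^esub>j\<in>J. if i = j then f j else \<zero>\<^bsub>R\<^esub>)"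
          using f by (intro R.finsum_cong') (auto simp: \<delta>_def carrier)
        also have "\<dots> = f i"
        proof (cases "i \<in> J")
          case True
          then show ?thesis
            using f J by (intro R.finsum_singleton) (auto simp: carrier)
        next
          case False
          then have "(\<Oplus>\<^bsub>R\<^esub>j\<in>J. if i = j then f j else \<zero>\<^bsub>R\<^esub>) = (\<Oplus>\<^bsub>R\<^esub>j\<in>J. \<zero>\<^bsub>R\<^esub>)"
            by (intro R.finsum_cong') auto
          then show ?thesis
            using False f by (simp add: carrier)
        qed
        finally show ?thesis ..
      qed
      then have "f = (\<Oplus>\<^bsub>?F\<^esub>j\<in>J. f j \<odot>\<^bsub>?F\<^esub> \<delta> j)"
        by (rule ext)
      also have "\<dots> = (\<Oplus>\<^bsub>?F\<^esub>j\<in>J. c (\<delta> j) \<odot>\<^bsub>?F\<^esub> \<delta> j)"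
        using sm c by (intro M.finsum_cong') auto
      also have "\<dots> = (\<Oplus>\<^bsub>?F\<^esub>v\<in>\<delta> ` J. c v \<odot>\<^bsub>?F\<^esub> v)"
        using inj \<delta> cR
        by (subst M.finsum_reindex) (auto simp del: free_module_simps)
      finally show "\<exists>c \<in> \<delta> ` J \<rightarrow> carrier R. f = (\<Oplus>\<^bsub>?F\<^esub>v\<in>\<delta> ` J. c v \<odot>\<^bsub>?F\<^esub> v)"
        using cR by blast
    qed
  qed
  then show ?thesis
    by (simp add: fg_module_def right_module_axioms)
qed

section \<open>Free covers and the splitting of projective modules\<close>

lemma (in right_module) smult_finsum:
  assumes "finite T" "a \<in> carrier R" "f \<in> T \<rightarrow> carrier M"
  shows "a \<odot>\<^bsub>M\<^esub> (\<Oplus>\<^bsub>M\<^esub>s\<in>T. f s) = (\<Oplus>\<^bsub>M\<^esub>s\<in>T. a \<odot>\<^bsub>M\<^esub> f s)"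
  using assms
proof (induction T rule: finite_induct)
  case (insert s T)
  then have "(\<lambda>s. a \<odot>\<^bsub>M\<^esub> f s) \<in> T \<rightarrow> carrier M" "f \<in> T \<rightarrow> carrier M" "f s \<in> carrier M"
    by auto
  with insert show ?case
    by (simp add: M.finsum_insert smult_r_distr)
qed (simp add: smult_zero_right)

lemma fg_module_quotient_of_free:
  fixes M :: "('r, 'm) module"
  assumes "fg_module R M"
  obtains J g where "finite J" "g \<in> module_homs R (free_module R J) M"
    "g ` carrier (free_module R J) = carrier M"
proof -
  interpret right_module R M
    using assms by (simp add: fg_module_def)
  obtain S where S: "finite S" "S \<subseteq> carrier M"
    and gen: "\<forall>x \<in> carrier M. \<exists>c \<in> S \<rightarrow> carrier R. x = (\<Oplus>\<^bsub>M\<^esub>s\<in>S. c s \<odot>\<^bsub>M\<^esub> s)"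
    using assms by (auto simp: fg_module_def finitely_generated_def)
  obtain e :: "'m \<Rightarrow> nat" where e: "inj_on e S"
    using finite_imp_inj_to_nat_seg[OF S(1)] by blast
  let ?F = "free_module R (e ` S)"
  \<comment> \<open>The unit vector at \<open>e s\<close> goes to the generator
    \<open>s\<close>.\<close>
  define g where "g f = (\<Oplus>\<^bsub>M\<^esub>s\<in>S. f (e s) \<odot>\<^bsub>M\<^esub> s)" for f
  have carrier: "f \<in> carrier ?F \<longleftrightarrow> (\<forall>i. f i \<in> carrier R) \<and> (\<forall>i. i \<notin> e ` S \<longrightarrow> f i = \<zero>\<^bsub>R\<^esub>)" for f
    by (simp add: carrier_free_module[OF R.ring_axioms])
  have SM: "s \<in> S \<Longrightarrow> s \<in> carrier M" for s
    using S by auto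
  have terms: "(\<lambda>s. f (e s) \<odot>\<^bsub>M\<^esub> s) \<in> S \<rightarrow> carrier M" if "f \<in> carrier ?F" for f
    using that SM by (auto simp: carrier)
  have hom: "g \<in> module_homs R ?F M"
    unfolding module_homs_def
  proof (intro CollectI conjI ballI Pi_I)
    fix f assume f: "f \<in> carrier ?F"
    show "g f \<in> carrier M"
      unfolding g_def by (rule M.finsum_closed[OF terms[OF f]])
    show "g (f \<oplus>\<^bsub>?F\<^esub> f') = g f \<oplus>\<^bsub>M\<^esub> g f'" if f': "f' \<in> carrier ?F" for f'
    proof -
      have "g (f \<oplus>\<^bsub>?F\<^esub> f') = (\<Oplus>\<^bsub>M\<^esub>s\<in>S. f (e s) \<odot>\<^bsub>M\<^esub> s \<oplus>\<^bsub>M\<^esub> f' (e s) \<odot>\<^bsub>M\<^esub> s)"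
        unfolding g_def using f f' SM
        by (intro M.finsum_cong') (auto simp: carrier smult_l_distr)
      then show ?thesis
        unfolding g_def using terms[OF f] terms[OF f'] by (simp add: M.finsum_addf)
    qed
    show "g (a \<odot>\<^bsub>?F\<^esub> f) = a \<odot>\<^bsub>M\<^esub> g f" if a: "a \<in> carrier R" for a
    proof -
      have "g (a \<odot>\<^bsub>?F\<^esub> f) = (\<Oplus>\<^bsub>M\<^esub>s\<in>S. a \<odot>\<^bsub>M\<^esub> (f (e s) \<odot>\<^bsub>M\<^esub> s))"
        unfolding g_def using f a SM
        by (intro M.finsum_cong') (auto simp: carrier smult_assoc)
      then show ?thesis
        unfolding g_def using smult_finsum[OF S(1) a terms[OF f]] by simp
    qed
  qed
  have "x \<in> g ` carrier ?F" if x: "x \<in> carrier M" for x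
  proof -
    obtain c where c: "c \<in> S \<rightarrow> carrier R" "x = (\<Oplus>\<^bsub>M\<^esub>s\<in>S. c s \<odot>\<^bsub>M\<^esub> s)"
      using gen x by blast
    define f where "f i = (if i \<in> e ` S then c (inv_into S e i) else \<zero>\<^bsub>R\<^esub>)" for i
    have fe: "f (e s) = c s" if "s \<in> S" for s
      using that e by (simp add: f_def)
    have "f \<in> carrier ?F"
      using c(1) e by (auto simp: carrier f_def)
    moreover have "g f = x"
      unfolding g_def c(2) using c(1) SM fe by (intro M.finsum_cong') auto
    ultimately show ?thesis by blast
  qed
  then have "g ` carrier ?F = carrier M"
    using module_homs_closed[OF hom] by auto
  with S(1) hom show thesis
    by (intro that[of "e ` S" g]) auto
qed

text \<open>The section \<open>k\<close> is a lift of the identity of \<open>P\<close> along a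
  surjection from a finitely generated free module.\<close>

lemma projective_retract_of_free:
  fixes P :: "'r fg_mod"
  assumes "projective R P"
  obtains J g k where "g \<in> module_homs R (free_module R J) P"
    "k \<in> module_homs R P (free_module R J)" "\<And>x. x \<in> carrier P \<Longrightarrow> g (k x) = x"
proof -
  have P: "fg_module R P"
    using assms by (simp add: projective_def)
  then have R: "ring R"
    by (simp add: fg_module_def right_module_def)
  obtain J g where J: "finite J" "g \<in> module_homs R (free_module R J) P"
    "g ` carrier (free_module R J) = carrier P"
    using fg_module_quotient_of_free[OF P] .
  have "(\<lambda>x. x) \<in> module_homs R P P"
    by (auto simp: module_homs_def)
  then obtain k where "k \<in> module_homs R P (free_module R J)" "\<forall>x \<in> carrier P. g (k x) = x"
    using assms J fg_module_free_module[OF R J(1)] P unfolding projective_def by metis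
  with J that show thesis by blast
qed


section \<open>Modules over the incidence algebra\<close>

lemma incidence_algebra_simps [simp]:
  "zero incidence_algebra = (\<lambda>_. 0)"
  "add incidence_algebra a b = (\<lambda>p. a p + b p)"
  "one incidence_algebra = (\<lambda>(x, y). if x = y then 1 else 0)"
  by (simp_all add: incidence_algebra_def)

lemma mem_incidence_algebra:
  "a \<in> carrier incidence_algebra \<longleftrightarrow> (\<forall>x y. \<not> x \<le> y \<longrightarrow> a (x, y) = 0)"
  by (simp add: incidence_algebra_def)

lemma incidence_basis_closed [simp]:
  "x \<le> y \<Longrightarrow> incidence_basis (x, y) \<in> carrier incidence_algebra"
  by (auto simp: mem_incidence_algebra incidence_basis_def)

section \<open>Matrix multiplication and columns in free modules\<close>

lemma incidence_mult_apply:
  assumes "a \<in> carrier incidence_algebra" "b \<in> carrier incidence_algebra"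
  shows "(a \<otimes>\<^bsub>incidence_algebra\<^esub> b) (x, z) = (\<Sum>y\<in>UNIV. a (x, y) * b (y, z))"
proof -
  have "(a \<otimes>\<^bsub>incidence_algebra\<^esub> b) (x, z) = (\<Sum>y | x \<le> y \<and> y \<le> z. a (x, y) * b (y, z))"
    by (simp add: incidence_algebra_def)
  also have "\<dots> = (\<Sum>y\<in>UNIV. a (x, y) * b (y, z))"
    using assms by (intro sum.mono_neutral_left) (auto simp: mem_incidence_algebra)
  finally show ?thesis .
qed

text \<open>Right multiplication by the matrix unit \<open>(y, z)\<close> moves column
  \<open>y\<close> to column \<open>z\<close> and erases everything else; computations in free
  modules reduce to this.\<close>

lemma incidence_mult_basis_apply:
  assumes "a \<in> carrier incidence_algebra" "y \<le> z"
  shows "(a \<otimes>\<^bsub>incidence_algebra\<^esub> incidence_basis (y, z)) (u, v) = (if v = z then a (u, y) else 0)"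
proof -
  have "(a \<otimes>\<^bsub>incidence_algebra\<^esub> incidence_basis (y, z)) (u, v)
      = (\<Sum>w\<in>UNIV. if w = y then (if v = z then a (u, y) else 0) else 0)"
    unfolding incidence_mult_apply[OF assms(1) incidence_basis_closed[OF assms(2)]]
    by (intro sum.cong) (auto simp: incidence_basis_def)
  then show ?thesis by simp
qed

text \<open>Being fixed by \<open>(c, c)\<close> means that every coordinate is concentrated in
  column \<open>c\<close>, and \<open>(c, a)\<close> merely relabels this column as
  \<open>a\<close>. The structure map from \<open>c\<close> to \<open>a\<close> is therefore
  injective.\<close>

lemma free_incidence_module_eqI:
  fixes f g :: "nat \<Rightarrow> 'a::{finite,order} \<times> 'a \<Rightarrow> 'k::field"
  assumes "c \<le> a"
    and f: "f \<in> carrier (free_module incidence_algebra J)"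
      "incidence_basis (c, c) \<odot>\<^bsub>free_module incidence_algebra J\<^esub> f = f"
    and g: "g \<in> carrier (free_module incidence_algebra J)"
      "incidence_basis (c, c) \<odot>\<^bsub>free_module incidence_algebra J\<^esub> g = g"
    and eq: "incidence_basis (c, a) \<odot>\<^bsub>free_module incidence_algebra J\<^esub> f =
       incidence_basis (c, a) \<odot>\<^bsub>free_module incidence_algebra J\<^esub> g"
  shows "f = g"
proof (intro ext)
  fix i and p :: "'a \<times> 'a"
  obtain u v where p: "p = (u, v)" by (cases p)
  have fi: "f i \<in> carrier incidence_algebra" and gi: "g i \<in> carrier incidence_algebra"
    using f g by (auto simp: carrier_free_module[OF ring_incidence_algebra])
  have "f i (u, c) = g i (u, c)"
    using fun_cong[OF fun_cong[OF eq], of i "(u, a)"] fi gi \<open>c \<le> a\<close>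
    by (simp add: incidence_mult_basis_apply)
  moreover have "f i (u, v) = (if v = c then f i (u, c) else 0)"
    using fun_cong[OF fun_cong[OF f(2)], of i "(u, v)"] fi
    by (simp add: incidence_mult_basis_apply)
  moreover have "g i (u, v) = (if v = c then g i (u, c) else 0)"
    using fun_cong[OF fun_cong[OF g(2)], of i "(u, v)"] gi
    by (simp add: incidence_mult_basis_apply)
  ultimately show "f i p = g i p"
    by (simp add: p)
qed

text \<open>The map \<open>k\<close> into a free module respects the action and has the left inverse
  \<open>g\<close>, so injectivity of structure maps is inherited from the free case.\<close>

lemma projective_incidence_module_eqI:
  fixes P :: "('a::{finite,order} \<times> 'a \<Rightarrow> 'k::field) fg_mod"
  assumes P: "projective incidence_algebra P" and "c \<le> a"
    and x: "x \<in> carrier P" "incidence_basis (c, c) \<odot>\<^bsub>P\<^esub> x = x"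
    and y: "y \<in> carrier P" "incidence_basis (c, c) \<odot>\<^bsub>P\<^esub> y = y"
    and eq: "incidence_basis (c, a) \<odot>\<^bsub>P\<^esub> x = incidence_basis (c, a) \<odot>\<^bsub>P\<^esub> y"
  shows "x = y"
proof -
  obtain J g k where k: "k \<in> module_homs incidence_algebra P (free_module incidence_algebra J)"
    and gk: "\<And>x. x \<in> carrier P \<Longrightarrow> g (k x) = x"
    using projective_retract_of_free[OF P] by metis
  note ks = module_homs_smult[OF k, symmetric]
  have "k x = k y"
    by (rule free_incidence_module_eqI[of c a _ J]) (simp_all del: free_module_simps add: ks module_homs_closed[OF k] \<open>c \<le> a\<close> x y eq)
  then show ?thesis
    using gk x y by metis
qed

text \<open>In a free module the two hypotheses say that \<open>u\<close> and \<open>v\<close> have the same coefficients, which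
  therefore vanish outside the elements below both \<open>a\<close> and \<open>b\<close>.\<close>

lemma free_incidence_module_amalgam:
  fixes a b :: "'a::{finite,lattice}" and u v :: "nat \<Rightarrow> 'a \<times> 'a \<Rightarrow> 'k::field"
  assumes "a \<le> t" "b \<le> t"
    and u: "u \<in> carrier (free_module incidence_algebra J)"
      "incidence_basis (a, a) \<odot>\<^bsub>free_module incidence_algebra J\<^esub> u = u"
    and v: "v \<in> carrier (free_module incidence_algebra J)"
    and eq: "incidence_basis (a, t) \<odot>\<^bsub>free_module incidence_algebra J\<^esub> u =
       incidence_basis (b, t) \<odot>\<^bsub>free_module incidence_algebra J\<^esub> v"
  obtains k where "k \<in> carrier (free_module incidence_algebra J)"
    "incidence_basis (inf a b, inf a b) \<odot>\<^bsub>free_module incidence_algebra J\<^esub> k = k"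
    "incidence_basis (inf a b, a) \<odot>\<^bsub>free_module incidence_algebra J\<^esub> k = u"
proof -
  note carrier = carrier_free_module[OF ring_incidence_algebra]
  have ui: "u i \<in> carrier incidence_algebra" and vi: "v i \<in> carrier incidence_algebra" for i
    using u v by (auto simp: carrier)
  have uv: "u i (x, a) = v i (x, b)" for i x
    using fun_cong[OF fun_cong[OF eq], of i "(x, t)"] ui vi assms
    by (simp add: incidence_mult_basis_apply)
  have ua: "u i (x, z) = (if z = a then u i (x, a) else 0)" for i x z
    using fun_cong[OF fun_cong[OF u(2)], of i "(x, z)"] ui
    by (simp add: incidence_mult_basis_apply)
  \<comment> \<open>The common coefficients, placed in column \<open>inf a b\<close>.\<close>
  define k where "k i = (\<lambda>(x, z). if z = inf a b then u i (x, a) else 0)" for i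
  have "u i (x, a) = 0" if "\<not> x \<le> inf a b" for i x
    using that ui[of i] vi[of i] uv[of i x] by (auto simp: mem_incidence_algebra)
  then have ki: "k i \<in> carrier incidence_algebra" for i
    by (auto simp: mem_incidence_algebra k_def)
  show thesis
  proof
    have "k i = \<zero>\<^bsub>incidence_algebra\<^esub>" if "i \<notin> J" for i
      using that u by (auto simp: carrier k_def)
    then show "k \<in> carrier (free_module incidence_algebra J)"
      using ki by (simp add: carrier)
    show "incidence_basis (inf a b, inf a b) \<odot>\<^bsub>free_module incidence_algebra J\<^esub> k = k"
      using ki by (auto simp: fun_eq_iff incidence_mult_basis_apply k_def)
    show "incidence_basis (inf a b, a) \<odot>\<^bsub>free_module incidence_algebra J\<^esub> k = u"
    proof (intro ext)
      fix i and p :: "'a \<times> 'a"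
      obtain x z where "p = (x, z)" by (cases p)
      then show "(incidence_basis (inf a b, a) \<odot>\<^bsub>free_module incidence_algebra J\<^esub> k) i p = u i p"
        using ki[of i] ua[of i x z] by (simp add: incidence_mult_basis_apply) (simp add: k_def)
    qed
  qed
qed

text \<open>The problem is moved by \<open>h\<close> into a free module, solved there, and the
  solution is returned by \<open>g\<close>, which inverts \<open>h\<close> on
  \<open>u\<close>.\<close>

lemma projective_incidence_module_amalgam:
  fixes P :: "('a::{finite,lattice} \<times> 'a \<Rightarrow> 'k::field) fg_mod"
  assumes P: "projective incidence_algebra P" and "a \<le> t" "b \<le> t"
    and u: "u \<in> carrier P" "incidence_basis (a, a) \<odot>\<^bsub>P\<^esub> u = u"
    and v: "v \<in> carrier P"
    and eq: "incidence_basis (a, t) \<odot>\<^bsub>P\<^esub> u = incidence_basis (b, t) \<odot>\<^bsub>P\<^esub> v"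
  obtains k where "k \<in> carrier P" "incidence_basis (inf a b, inf a b) \<odot>\<^bsub>P\<^esub> k = k"
    "incidence_basis (inf a b, a) \<odot>\<^bsub>P\<^esub> k = u"
proof -
  obtain J g h where g: "g \<in> module_homs incidence_algebra (free_module incidence_algebra J) P"
    and h: "h \<in> module_homs incidence_algebra P (free_module incidence_algebra J)"
    and gh: "\<And>x. x \<in> carrier P \<Longrightarrow> g (h x) = x"
    using projective_retract_of_free[OF P] by metis
  note hs = module_homs_smult[OF h, symmetric] and gs = module_homs_smult[OF g, symmetric]
  have hu: "h u \<in> carrier (free_module incidence_algebra J)"
    using u(1) by (rule module_homs_closed[OF h])
  have hu': "incidence_basis (a, a) \<odot>\<^bsub>free_module incidence_algebra J\<^esub> h u = h u"
    unfolding hs[OF incidence_basis_closed[OF order_refl] u(1)] u(2) ..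
  have hv: "h v \<in> carrier (free_module incidence_algebra J)"
    using v by (rule module_homs_closed[OF h])
  have huv: "incidence_basis (a, t) \<odot>\<^bsub>free_module incidence_algebra J\<^esub> h u =
      incidence_basis (b, t) \<odot>\<^bsub>free_module incidence_algebra J\<^esub> h v"
    unfolding hs[OF incidence_basis_closed[OF \<open>a \<le> t\<close>] u(1)]
      hs[OF incidence_basis_closed[OF \<open>b \<le> t\<close>] v] eq ..
  obtain k where k: "k \<in> carrier (free_module incidence_algebra J)"
    "incidence_basis (inf a b, inf a b) \<odot>\<^bsub>free_module incidence_algebra J\<^esub> k = k"
    "incidence_basis (inf a b, a) \<odot>\<^bsub>free_module incidence_algebra J\<^esub> k = h u"
    using free_incidence_module_amalgam[OF \<open>a \<le> t\<close> \<open>b \<le> t\<close> hu hu' hv huv] .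
  show thesis
  proof (rule that[of "g k"])
    show "g k \<in> carrier P"
      using k by (simp add: module_homs_closed[OF g])
    show "incidence_basis (inf a b, inf a b) \<odot>\<^bsub>P\<^esub> g k = g k"
      using k by (simp add: gs del: free_module_simps)
    show "incidence_basis (inf a b, a) \<odot>\<^bsub>P\<^esub> g k = u"
      using k gh u by (simp add: gs del: free_module_simps)
  qed
qed


section \<open>Interval modules\<close>

text \<open>The indecomposable module with support \<open>{x..w}\<close>. For the largest \<open>w\<close> it is the projective
  \<open>e\<^sub>x A\<close>, for the least \<open>x\<close> the injective \<open>D (A e\<^sub>w)\<close>, for \<open>x = w\<close> it is simple.\<close>

definition interval_module :: "'a::{finite,order} \<Rightarrow> 'a \<Rightarrow> ('a \<times> 'a \<Rightarrow> 'k::field, 'a \<Rightarrow> 'k) module" where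
  "interval_module x w =
     \<lparr>carrier = {f. \<forall>z. \<not> (x \<le> z \<and> z \<le> w) \<longrightarrow> f z = 0},
      mult = undefined, one = undefined, zero = (\<lambda>_. 0), add = (\<lambda>f g z. f z + g z),
      smult = (\<lambda>a f z. if z \<le> w then \<Sum>u\<in>UNIV. f u * a (u, z) else 0)\<rparr>"

definition point_mass :: "'a \<Rightarrow> 'a \<Rightarrow> 'k::field" where
  "point_mass x = (\<lambda>z. if z = x then 1 else 0)"

lemma interval_module_simps [simp]:
  "zero (interval_module x w) = (\<lambda>_. 0)"
  "add (interval_module x w) f g = (\<lambda>z. f z + g z)"
  "smult (interval_module x w) a f = (\<lambda>z. if z \<le> w then \<Sum>u\<in>UNIV. f u * a (u, z) else 0)"
  by (simp_all add: interval_module_def)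

lemma mem_interval_module:
  "f \<in> carrier (interval_module x w) \<longleftrightarrow> (\<forall>z. \<not> (x \<le> z \<and> z \<le> w) \<longrightarrow> f z = 0)"
  by (simp add: interval_module_def)

lemma point_mass_mem [simp]:
  "x \<le> y \<Longrightarrow> y \<le> w \<Longrightarrow> point_mass y \<in> carrier (interval_module x w)"
  by (auto simp: mem_interval_module point_mass_def)

lemma smult_point_mass:
  "a \<odot>\<^bsub>interval_module x w\<^esub> point_mass y = (\<lambda>z. if z \<le> w then a (y, z) else 0)"
  by (auto simp: fun_eq_iff point_mass_def if_distrib[of "\<lambda>c. c * _"] cong: if_cong)

lemma basis_smult_point_mass:
  "incidence_basis (y, z) \<odot>\<^bsub>interval_module x w\<^esub> point_mass y =
     (if z \<le> w then point_mass z else \<zero>\<^bsub>interval_module x w\<^esub>)"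
  unfolding smult_point_mass by (auto simp: fun_eq_iff incidence_basis_def point_mass_def)

lemma right_module_interval_module:
  "right_module incidence_algebra (interval_module x w :: ('a::{finite,order} \<times> 'a \<Rightarrow> 'k::field, 'a \<Rightarrow> 'k) module)"
proof -
  let ?A = "incidence_algebra :: ('k, 'a \<times> 'a \<Rightarrow> 'k) module"
  let ?M = "interval_module x w :: ('a \<times> 'a \<Rightarrow> 'k, 'a \<Rightarrow> 'k) module"
  have "abelian_group ?M"
  proof (rule abelian_groupI)
    show "\<exists>g \<in> carrier ?M. g \<oplus>\<^bsub>?M\<^esub> f = \<zero>\<^bsub>?M\<^esub>" if "f \<in> carrier ?M" for f
      using that by (intro bexI[of _ "\<lambda>z. - f z"]) (auto simp: mem_interval_module)
  qed (auto simp: mem_interval_module algebra_simps)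
  then show ?thesis
  proof (intro right_module.intro right_module_axioms.intro ring_incidence_algebra)
    fix a f assume a: "a \<in> carrier ?A" and f: "f \<in> carrier ?M"
    \<comment> \<open>A nonzero term would force \<open>x \<le> u\<close> and
      \<open>u \<le> z\<close>.\<close>
    have "f u * a (u, z) = 0" if "\<not> x \<le> z" for u z
      using a f that by (auto simp: mem_incidence_algebra mem_interval_module dest: order_trans)
    then show "a \<odot>\<^bsub>?M\<^esub> f \<in> carrier ?M"
      by (auto simp: mem_interval_module intro!: sum.neutral)
  next
    fix a b f
    assume a: "a \<in> carrier ?A"
      and b: "b \<in> carrier ?A" and f: "f \<in> carrier ?M"
    have "(\<Sum>u\<in>UNIV. f u * (\<Sum>v\<in>UNIV. a (u, v) * b (v, z)))
        = (\<Sum>v\<in>UNIV. (if v \<le> w then \<Sum>u\<in>UNIV. f u * a (u, v) else 0) * b (v, z))" if "z \<le> w" for z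
    proof -
      have "(\<Sum>u\<in>UNIV. f u * (\<Sum>v\<in>UNIV. a (u, v) * b (v, z)))
          = (\<Sum>v\<in>UNIV. \<Sum>u\<in>UNIV. f u * a (u, v) * b (v, z))"
        by (subst sum.swap) (simp add: sum_distrib_left mult.assoc)
      \<comment> \<open>\<open>b (v, z)\<close> vanishes unless \<open>v \<le> z\<close>, hence
        \<open>v \<le> w\<close>, so cutting the inner sum off at \<open>w\<close> changes
        nothing.\<close>
      also have "\<dots> = (\<Sum>v\<in>UNIV. (if v \<le> w then \<Sum>u\<in>UNIV. f u * a (u, v) else 0) * b (v, z))"
        using b that by (intro sum.cong)
          (auto simp: mem_incidence_algebra sum_distrib_right intro!: sum.neutral dest: order_trans)
      finally show ?thesis .
    qed
    then show "(a \<otimes>\<^bsub>incidence_algebra\<^esub> b) \<odot>\<^bsub>?M\<^esub> f = b \<odot>\<^bsub>?M\<^esub> (a \<odot>\<^bsub>?M\<^esub> f)"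
      using a b by (auto simp: fun_eq_iff incidence_mult_apply)
  next
    fix f assume f: "f \<in> carrier ?M"
    have "(\<Sum>u\<in>UNIV. f u * (if u = z then 1 else 0)) = (\<Sum>u\<in>UNIV. if u = z then f u else 0)" for z
      by (intro sum.cong) auto
    then show "\<one>\<^bsub>?A\<^esub> \<odot>\<^bsub>?M\<^esub> f = f"
      using f by (auto simp: fun_eq_iff mem_interval_module)
  qed (simp_all add: fun_eq_iff distrib_left distrib_right sum.distrib)
qed

lemma fg_interval_module:
  assumes "x \<le> w"
  shows "fg_module incidence_algebra (interval_module x w :: ('a::{finite,order} \<times> 'a \<Rightarrow> 'k::field, 'a \<Rightarrow> 'k) module)"
proof -
  let ?A = "incidence_algebra :: ('k, 'a \<times> 'a \<Rightarrow> 'k) module"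
  let ?M = "interval_module x w :: ('a \<times> 'a \<Rightarrow> 'k, 'a \<Rightarrow> 'k) module"
  interpret right_module ?A ?M
    by (rule right_module_interval_module)
  have "finitely_generated ?A ?M"
    unfolding finitely_generated_def
  proof (intro exI conjI ballI)
    show "finite {point_mass x}" "{point_mass x} \<subseteq> carrier ?M"
      using assms by auto
    fix f assume f: "f \<in> carrier ?M"
    \<comment> \<open>The matrix with row \<open>x\<close> equal to \<open>f\<close> carries the
      generator \<open>point_mass x\<close> to \<open>f\<close>.\<close>
    define a where "a = (\<lambda>(u, v). if u = x then f v else 0)"
    have a: "a \<in> carrier ?A"
      using f by (auto simp: a_def mem_incidence_algebra mem_interval_module)
    have "f = a \<odot>\<^bsub>?M\<^esub> point_mass x"
      using f unfolding smult_point_mass by (auto simp: a_def mem_interval_module)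
    also have "\<dots> = (\<Oplus>\<^bsub>?M\<^esub>s\<in>{point_mass x}. a \<odot>\<^bsub>?M\<^esub> s)"
      using a assms by (subst M.finsum_insert) (auto simp del: interval_module_simps)
    finally show "\<exists>c \<in> {point_mass x} \<rightarrow> carrier ?A. f = (\<Oplus>\<^bsub>?M\<^esub>s\<in>{point_mass x}. c s \<odot>\<^bsub>?M\<^esub> s)"
      using a by (intro bexI[of _ "\<lambda>_. a"]) auto
  qed
  then show ?thesis
    by (simp add: fg_module_def right_module_axioms)
qed

section \<open>Maps out of interval modules and extension of socle elements\<close>

lemma interval_module_inclusion:
  "x \<le> x' \<Longrightarrow> (\<lambda>f. f) \<in> module_homs incidence_algebra (interval_module x' w) (interval_module x w)"
  by (auto simp: module_homs_def mem_interval_module dest: order_trans)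

text \<open>This is the embedding of \<open>e\<^sub>x A\<close> into the algebra as the matrices
  supported in row \<open>x\<close>.\<close>

lemma interval_module_row_hom:
  assumes top: "\<And>z. z \<le> w"
  shows "(\<lambda>f (u, v). if u = x then f v else 0) \<in>
     module_homs incidence_algebra (interval_module x w) (regular_module incidence_algebra)"
proof -
  have row: "(\<lambda>(u, v). if u = x then f v else 0) \<in> carrier incidence_algebra"
    if "f \<in> carrier (interval_module x w)" for f :: "'a \<Rightarrow> 'b"
    using that by (auto simp: mem_incidence_algebra mem_interval_module)
  show ?thesis
    unfolding module_homs_def using row top
    by (auto simp: regular_module_def fun_eq_iff incidence_mult_apply)
qed

text \<open>Since \<open>s\<close> lives at \<open>y\<close> and is killed by everything leading
  strictly above \<open>y\<close>, the simple module \<open>interval_module y y\<close> maps to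
  \<open>I\<close> with its generator going to \<open>s\<close>. Injectivity extends this map to the
  larger module \<open>interval_module bt y\<close>.\<close>

lemma injective_extend_socle:
  fixes I :: "('a::{finite,order} \<times> 'a \<Rightarrow> 'k::field) fg_mod"
  assumes I: "injective incidence_algebra I" and bot: "\<And>z. bt \<le> z"
    and s: "s \<in> carrier I" "incidence_basis (y, y) \<odot>\<^bsub>I\<^esub> s = s"
    and ann: "\<And>b. b \<in> carrier incidence_algebra \<Longrightarrow> (\<And>u v. \<not> (u = y \<and> y < v) \<Longrightarrow> b (u, v) = 0) \<Longrightarrow>
      b \<odot>\<^bsub>I\<^esub> s = \<zero>\<^bsub>I\<^esub>"
  obtains t where "t \<in> module_homs incidence_algebra (interval_module bt y) I" "t (point_mass y) = s"
proof -
  interpret I: right_module incidence_algebra I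
    using I by (simp add: injective_def fg_module_def)
  \<comment> \<open>The multiple of the idempotent \<open>(y, y)\<close> by \<open>c\<close>:
    scalars of the field act on \<open>I\<close> only through the algebra.\<close>
  define \<sigma> :: "'k \<Rightarrow> 'a \<times> 'a \<Rightarrow> 'k" where "\<sigma> c = (\<lambda>p. if p = (y, y) then c else 0)" for c
  have \<sigma>: "\<sigma> c \<in> carrier incidence_algebra" for c
    by (auto simp: \<sigma>_def mem_incidence_algebra)
  have hom: "(\<lambda>f. \<sigma> (f y) \<odot>\<^bsub>I\<^esub> s) \<in> module_homs incidence_algebra (interval_module y y) I"
    unfolding module_homs_def
  proof (intro CollectI conjI ballI Pi_I)
    fix f assume f: "f \<in> carrier (interval_module y y :: ('a \<times> 'a \<Rightarrow> 'k, 'a \<Rightarrow> 'k) module)"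
    show "\<sigma> (f y) \<odot>\<^bsub>I\<^esub> s \<in> carrier I"
      using \<sigma> s by simp
    show "\<sigma> ((f \<oplus>\<^bsub>interval_module y y\<^esub> g) y) \<odot>\<^bsub>I\<^esub> s = \<sigma> (f y) \<odot>\<^bsub>I\<^esub> s \<oplus>\<^bsub>I\<^esub> \<sigma> (g y) \<odot>\<^bsub>I\<^esub> s" for g
    proof -
      have "\<sigma> ((f \<oplus>\<^bsub>interval_module y y\<^esub> g) y) = \<sigma> (f y) \<oplus>\<^bsub>incidence_algebra\<^esub> \<sigma> (g y)"
        by (auto simp: \<sigma>_def)
      then show ?thesis
        using I.smult_l_distr[OF \<sigma> \<sigma> s(1)] by simp
    qed
    fix a assume a: "a \<in> carrier (incidence_algebra :: ('k, 'a \<times> 'a \<Rightarrow> 'k) module)"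
    \<comment> \<open>The off-diagonal part of \<open>f y\<close> times row \<open>y\<close> of
      \<open>a\<close>. It is of the kind that \<open>ann\<close> kills, which leaves the diagonal
      scalar \<open>f y * a (y, y)\<close>.\<close>
    define b where "b = (\<lambda>(u, v). if u = y \<and> v \<noteq> y then f y * a (y, v) else 0)"
    have b: "b \<in> carrier incidence_algebra"
      using a by (auto simp: b_def mem_incidence_algebra)
    have "b (u, v) = 0" if "\<not> (u = y \<and> y < v)" for u v
      using a that by (auto simp: b_def mem_incidence_algebra order.strict_iff_order)
    then have bs: "b \<odot>\<^bsub>I\<^esub> s = \<zero>\<^bsub>I\<^esub>"
      using b ann by blast
    have fz: "f u = 0" if "u \<noteq> y" for u
      using f that by (auto simp: mem_interval_module)
    have "(\<Sum>u\<in>UNIV. f u * a (u, y)) = (\<Sum>u\<in>UNIV. if u = y then f y * a (y, y) else 0)"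
      by (intro sum.cong) (auto simp: fz)
    then have fa: "(a \<odot>\<^bsub>interval_module y y\<^esub> f) y = f y * a (y, y)"
      by simp
    have "(\<sigma> (f y) \<otimes>\<^bsub>incidence_algebra\<^esub> a) (u, v)
        = (\<Sum>z\<in>UNIV. if z = y then (if u = y then f y * a (y, v) else 0) else 0)" for u v
      unfolding incidence_mult_apply[OF \<sigma> a] by (intro sum.cong) (auto simp: \<sigma>_def)
    then have "\<sigma> (f y) \<otimes>\<^bsub>incidence_algebra\<^esub> a = \<sigma> (f y * a (y, y)) \<oplus>\<^bsub>incidence_algebra\<^esub> b"
      by (auto simp: fun_eq_iff \<sigma>_def b_def)
    then have "a \<odot>\<^bsub>I\<^esub> (\<sigma> (f y) \<odot>\<^bsub>I\<^esub> s) = \<sigma> (f y * a (y, y)) \<odot>\<^bsub>I\<^esub> s \<oplus>\<^bsub>I\<^esub> b \<odot>\<^bsub>I\<^esub> s"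
      using I.smult_assoc[OF \<sigma> a s(1)] I.smult_l_distr[OF \<sigma> b s(1)] by metis
    then show "\<sigma> ((a \<odot>\<^bsub>interval_module y y\<^esub> f) y) \<odot>\<^bsub>I\<^esub> s = a \<odot>\<^bsub>I\<^esub> (\<sigma> (f y) \<odot>\<^bsub>I\<^esub> s)"
      unfolding fa using bs \<sigma> s by simp
  qed
  obtain t where t: "t \<in> module_homs incidence_algebra (interval_module bt y) I"
    "\<And>f. f \<in> carrier (interval_module y y) \<Longrightarrow> t f = \<sigma> (f y) \<odot>\<^bsub>I\<^esub> s"
    using injective_extend[OF I fg_interval_module[OF order_refl] fg_interval_module[OF bot]
        interval_module_inclusion[OF bot] _ hom] by auto
  have "\<sigma> 1 = incidence_basis (y, y)"
    by (auto simp: \<sigma>_def incidence_basis_def)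
  moreover have pm: "point_mass y y = (1 :: 'k)"
    by (simp add: point_mass_def)
  ultimately have "t (point_mass y) = s"
    using t(2)[OF point_mass_mem[OF order_refl order_refl]] s pm by simp
  with t(1) show thesis
    by (rule that)
qed


section \<open>The Auslander condition and distributivity\<close>

text \<open>If \<open>y'\<close> is the only upper cover of \<open>y\<close>, then \<open>e\<^sub>y A\<close> is a nonsplit extension of the simple
  module at \<open>y\<close> by \<open>e\<^sub>y\<^sub>' A\<close>, so this simple module embeds into \<open>I 1\<close>.\<close>

lemma socle_of_coresolution:
  fixes I :: "nat \<Rightarrow> ('a::{finite,order} \<times> 'a \<Rightarrow> 'k::field) fg_mod" and tp y y' :: 'a
  assumes res: "injective_coresolution incidence_algebra (regular_module incidence_algebra) I \<epsilon> d"
    and top: "\<And>z. z \<le> tp" and y: "y < y'" "\<And>z. y < z \<Longrightarrow> y' \<le> z"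
  obtains s where "s \<in> carrier (I 1)" "s \<noteq> \<zero>\<^bsub>I 1\<^esub>" "incidence_basis (y, y) \<odot>\<^bsub>I 1\<^esub> s = s"
    "\<And>b. b \<in> carrier incidence_algebra \<Longrightarrow> (\<And>u v. \<not> (u = y \<and> y < v) \<Longrightarrow> b (u, v) = 0) \<Longrightarrow>
      b \<odot>\<^bsub>I 1\<^esub> s = \<zero>\<^bsub>I 1\<^esub>"
proof -
  let ?A = "incidence_algebra :: ('k, 'a \<times> 'a \<Rightarrow> 'k) module"
  let ?M = "interval_module y tp :: ('a \<times> 'a \<Rightarrow> 'k, 'a \<Rightarrow> 'k) module"
  let ?M' = "interval_module y' tp :: ('a \<times> 'a \<Rightarrow> 'k, 'a \<Rightarrow> 'k) module"
  define row :: "('a \<Rightarrow> 'k) \<Rightarrow> 'a \<times> 'a \<Rightarrow> 'k" where "row f = (\<lambda>(u, v). if u = y' then f v else 0)" for f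
  have inj: "injective ?A (I 0)" and \<epsilon>: "\<epsilon> \<in> module_homs ?A (regular_module ?A) (I 0)"
    and d: "d 0 \<in> module_homs ?A (I 0) (I 1)" and inj_\<epsilon>: "inj_on \<epsilon> (carrier ?A)"
    and img: "\<epsilon> ` carrier ?A = module_kernel (I 0) (I 1) (d 0)"
    using res by (auto simp: injective_coresolution_def regular_module_def)
  interpret A: ring ?A
    by (rule ring_incidence_algebra)
  have yy': "y \<le> y'"
    using y(1) by simp
  have row: "row \<in> module_homs ?A ?M' (regular_module ?A)"
    using interval_module_row_hom[OF top] unfolding row_def .
  \<comment> \<open>Injectivity of \<open>I 0\<close> extends the composite of \<open>row\<close>
    and \<open>\<epsilon>\<close> from \<open>e\<^sub>y\<^sub>' A\<close> to
    \<open>e\<^sub>y A\<close>.\<close>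
  obtain k where k: "k \<in> module_homs ?A ?M (I 0)" and k_row: "\<And>f. f \<in> carrier ?M' \<Longrightarrow> k f = \<epsilon> (row f)"
    using injective_extend[OF inj fg_interval_module[OF top] fg_interval_module[OF top]
        interval_module_inclusion[OF yy'] _ module_homs_comp[OF row \<epsilon>]] by auto
  \<comment> \<open>The image of the generator of \<open>e\<^sub>y A\<close>; \<open>d 0 m\<close>
    will be the socle element.\<close>
  define m where "m = k (point_mass y)"
  have pm: "point_mass y \<in> carrier ?M"
    using top by simp
  have m: "m \<in> carrier (I 0)"
    unfolding m_def by (rule module_homs_closed[OF k pm])
  have m_smult: "a \<odot>\<^bsub>I 0\<^esub> m = k (a \<odot>\<^bsub>?M\<^esub> point_mass y)" if "a \<in> carrier ?A" for a
    unfolding m_def by (rule module_homs_smult[OF k that pm, symmetric])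
  have d_smult: "a \<odot>\<^bsub>I 1\<^esub> d 0 m = d 0 (a \<odot>\<^bsub>I 0\<^esub> m)" if "a \<in> carrier ?A" for a
    by (rule module_homs_smult[OF d that m, symmetric])
  have row_basis: "row (point_mass y') = incidence_basis (y', y')"
    by (auto simp: row_def point_mass_def incidence_basis_def)
  show thesis
  proof (rule that[of "d 0 m"])
    show "d 0 m \<in> carrier (I 1)"
      by (rule module_homs_closed[OF d m])
    show "d 0 m \<noteq> \<zero>\<^bsub>I 1\<^esub>"
    proof
      assume "d 0 m = \<zero>\<^bsub>I 1\<^esub>"
      then have "m \<in> \<epsilon> ` carrier ?A"
        using m by (auto simp: img module_kernel_def)
      then obtain a where a: "a \<in> carrier ?A" "m = \<epsilon> a"
        by auto
      \<comment> \<open>If \<open>m\<close> came from \<open>a\<close>, then \<open>a\<close> times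
        \<open>(y, y')\<close> would be \<open>(y', y')\<close>. But the entry of that product at
        \<open>(y', y')\<close> is \<open>a (y', y)\<close>, which is zero because
        \<open>y < y'\<close>.\<close>
      have E: "incidence_basis (y, y') \<in> carrier ?A"
        using yy' by simp
      have "\<epsilon> (a \<otimes>\<^bsub>?A\<^esub> incidence_basis (y, y')) = incidence_basis (y, y') \<odot>\<^bsub>I 0\<^esub> m"
        using module_homs_smult[OF \<epsilon> E] a by (simp add: regular_module_def)
      also have "\<dots> = k (point_mass y')"
        using top by (simp only: m_smult[OF E] basis_smult_point_mass if_True)
      also have "\<dots> = \<epsilon> (incidence_basis (y', y'))"
        using k_row[of "point_mass y'"] top by (simp add: row_basis)
      finally have "a \<otimes>\<^bsub>?A\<^esub> incidence_basis (y, y') = incidence_basis (y', y')"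
        using inj_\<epsilon> a(1) E by (auto dest!: inj_onD)
      then have "(a \<otimes>\<^bsub>?A\<^esub> incidence_basis (y, y')) (y', y') = 1"
        by (simp add: incidence_basis_def)
      then show False
        using a(1) y(1) yy' by (auto simp: incidence_mult_basis_apply mem_incidence_algebra)
    qed
    show "incidence_basis (y, y) \<odot>\<^bsub>I 1\<^esub> d 0 m = d 0 m"
      using top unfolding d_smult[OF incidence_basis_closed[OF order_refl]]
        m_smult[OF incidence_basis_closed[OF order_refl]] basis_smult_point_mass by (simp add: m_def)
    show "b \<odot>\<^bsub>I 1\<^esub> d 0 m = \<zero>\<^bsub>I 1\<^esub>"
      if b: "b \<in> carrier ?A" "\<And>u v. \<not> (u = y \<and> y < v) \<Longrightarrow> b (u, v) = 0" for b
    proof -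
      \<comment> \<open>As \<open>y'\<close> lies below everything strictly above \<open>y\<close>,
        such a \<open>b\<close> carries the generator into \<open>e\<^sub>y\<^sub>' A\<close>. There
        \<open>k\<close> takes values in the image of \<open>\<epsilon>\<close>, which
        \<open>d 0\<close> kills.\<close>
      have bM': "b \<odot>\<^bsub>?M\<^esub> point_mass y \<in> carrier ?M'"
        unfolding smult_point_mass mem_interval_module using b(2) y(2) by auto
      have "b \<odot>\<^bsub>I 0\<^esub> m = \<epsilon> (row (b \<odot>\<^bsub>?M\<^esub> point_mass y))"
        using k_row[OF bM'] by (simp add: m_smult[OF b(1)])
      moreover have "row (b \<odot>\<^bsub>?M\<^esub> point_mass y) \<in> carrier ?A"
        using module_homs_closed[OF row bM'] by (simp add: regular_module_def)
      ultimately have "b \<odot>\<^bsub>I 0\<^esub> m \<in> module_kernel (I 0) (I 1) (d 0)"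
        using img by auto
      then show ?thesis
        unfolding d_smult[OF b(1)] by (simp add: module_kernel_def)
    qed
  qed
qed

section \<open>From bounded projective dimension to meet-prime elements\<close>

lemma auslander_condition_imp_meet_prime:
  fixes y y' a b :: "'a::{finite,lattice}"
  assumes "auslander_condition (incidence_algebra :: ('k::field, 'a \<times> 'a \<Rightarrow> 'k) module)"
    and y: "y < y'" "\<And>z. y < z \<Longrightarrow> y' \<le> z" and ab: "inf a b \<le> y"
  shows "a \<le> y \<or> b \<le> y"
proof (rule ccontr)
  \<comment> \<open>Keeps the index in \<open>I 1\<close> and \<open>P 1\<close> from being
    rewritten to \<open>Suc 0\<close>.\<close>
  note One_nat_def [simp del]
  assume "\<not> (a \<le> y \<or> b \<le> y)"
  then have a: "\<not> a \<le> y" and b: "\<not> b \<le> y" by auto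
  let ?A = "incidence_algebra :: ('k, 'a \<times> 'a \<Rightarrow> 'k) module"
  let ?E = "\<lambda>x z. incidence_basis (x, z) :: 'a \<times> 'a \<Rightarrow> 'k"
  obtain tp :: 'a where top: "\<And>z. z \<le> tp"
    by (meson Sup_fin.coboundedI UNIV_I finite)
  obtain bt :: 'a where bot: "\<And>z. bt \<le> z"
    by (meson Inf_fin.coboundedI UNIV_I finite)
  \<comment> \<open>The case \<open>n = 2\<close> of the Auslander condition, which bounds the
    projective dimension of \<open>I 1\<close> by one.\<close>
  obtain I \<epsilon> d where res: "injective_coresolution ?A (regular_module ?A) I \<epsilon> d"
    and pd: "\<forall>i<2. pdim ?A (I i) \<le> enat i"
    using assms(1) unfolding auslander_condition_def by (metis one_le_numeral)
  have inj: "injective ?A (I 1)"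
    using res by (auto simp: injective_coresolution_def)
  then interpret I: right_module ?A "I 1"
    by (simp add: injective_def fg_module_def)
  obtain s where s: "s \<in> carrier (I 1)" "s \<noteq> \<zero>\<^bsub>I 1\<^esub>" "?E y y \<odot>\<^bsub>I 1\<^esub> s = s"
    and ann: "\<And>b. b \<in> carrier incidence_algebra \<Longrightarrow> (\<And>u v. \<not> (u = y \<and> y < v) \<Longrightarrow> b (u, v) = 0) \<Longrightarrow>
      b \<odot>\<^bsub>I 1\<^esub> s = \<zero>\<^bsub>I 1\<^esub>"
    using socle_of_coresolution[OF res top y] by metis
  let ?Y = "interval_module bt y :: ('a \<times> 'a \<Rightarrow> 'k, 'a \<Rightarrow> 'k) module"
  interpret Y: right_module ?A ?Y
    by (rule right_module_interval_module)
  obtain t where t: "t \<in> module_homs ?A ?Y (I 1)" and ts: "t (point_mass y) = s"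
    using injective_extend_socle[OF inj bot s(1,3) ann] by metis
  have pm: "point_mass bt \<in> carrier ?Y"
    using bot by simp
  have t0: "t \<zero>\<^bsub>?Y\<^esub> = \<zero>\<^bsub>I 1\<^esub>"
    by (rule module_homs_zero[OF Y.abelian_group_axioms I.abelian_group_axioms t])
  have t_basis: "?E bt z \<odot>\<^bsub>I 1\<^esub> t (point_mass bt) = (if z \<le> y then t (point_mass z) else \<zero>\<^bsub>I 1\<^esub>)" for z
    using module_homs_smult[OF t incidence_basis_closed[OF bot[of z]] pm]
    unfolding basis_smult_point_mass using t0 by (metis (full_types))
  have "pdim ?A (I 1) \<le> enat 1"
    using pd by simp
  then obtain P \<pi> \<delta> where P: "projective_resolution ?A (I 1) P \<pi> \<delta>"
    "\<And>i. i > 1 \<Longrightarrow> carrier (P i) = {\<zero>\<^bsub>P i\<^esub>}"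
    using pdim_leD by metis
  have proj: "projective ?A (P i)" for i
    using P(1) by (simp add: projective_resolution_def)
  then have rm: "right_module ?A (P i)" for i
    by (simp add: projective_def fg_module_def)
  interpret P0: right_module ?A "P 0" by (rule rm)
  interpret P1: right_module ?A "P 1" by (rule rm)
  interpret P2: right_module ?A "P 2" by (rule rm)
  have \<pi>: "\<pi> \<in> module_homs ?A (P 0) (I 1)" and \<pi>_surj: "\<pi> ` carrier (P 0) = carrier (I 1)"
    and \<delta>: "\<delta> 0 \<in> module_homs ?A (P 1) (P 0)" and \<delta>1: "\<delta> 1 \<in> module_homs ?A (P 2) (P 1)"
    and \<delta>_img: "\<delta> 0 ` carrier (P 1) = module_kernel (P 0) (I 1) \<pi>"
    and \<delta>1_img: "\<delta> 1 ` carrier (P 2) = module_kernel (P 1) (P 0) (\<delta> 0)"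
    using P(1) unfolding projective_resolution_def by (auto simp: numeral_2_eq_2 One_nat_def)
  \<comment> \<open>\<open>P 2\<close> is zero, so by exactness the kernel of
    \<open>\<delta> 0\<close> is zero.\<close>
  have ker: "module_kernel (P 1) (P 0) (\<delta> 0) = {\<zero>\<^bsub>P 1\<^esub>}"
    using \<delta>1_img P(2)[of 2] module_homs_zero[OF P2.abelian_group_axioms P1.abelian_group_axioms \<delta>1] by auto
  have inj_\<delta>: "x = x'" if x: "x \<in> carrier (P 1)" "x' \<in> carrier (P 1)" "\<delta> 0 x = \<delta> 0 x'" for x x'
  proof -
    have n: "\<ominus>\<^bsub>P 1\<^esub> x' \<in> carrier (P 1)"
      using x(2) by (rule P1.a_inv_closed)
    have "\<delta> 0 (x \<oplus>\<^bsub>P 1\<^esub> \<ominus>\<^bsub>P 1\<^esub> x') = \<delta> 0 (x' \<oplus>\<^bsub>P 1\<^esub> \<ominus>\<^bsub>P 1\<^esub> x')"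
      unfolding module_homs_add[OF \<delta> x(1) n] module_homs_add[OF \<delta> x(2) n] x(3) ..
    also have "\<dots> = \<zero>\<^bsub>P 0\<^esub>"
      unfolding P1.r_neg[OF x(2)]
      by (rule module_homs_zero[OF P1.abelian_group_axioms P0.abelian_group_axioms \<delta>])
    finally have "x \<oplus>\<^bsub>P 1\<^esub> \<ominus>\<^bsub>P 1\<^esub> x' \<in> module_kernel (P 1) (P 0) (\<delta> 0)"
      using P1.a_closed[OF x(1) n] by (simp add: module_kernel_def)
    then have "x \<oplus>\<^bsub>P 1\<^esub> \<ominus>\<^bsub>P 1\<^esub> x' = \<zero>\<^bsub>P 1\<^esub>"
      by (simp add: ker)
    then show ?thesis
      using P1.minus_equality[OF _ n x(1)] P1.minus_minus[OF x(2)] by simp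
  qed
  obtain q where q: "q \<in> carrier (P 0)" "\<pi> q = t (point_mass bt)"
    using module_homs_closed[OF t pm] unfolding \<pi>_surj[symmetric] by auto
  have E_E: "?E x' z \<odot>\<^bsub>P 0\<^esub> (?E x x' \<odot>\<^bsub>P 0\<^esub> q) = ?E x z \<odot>\<^bsub>P 0\<^esub> q" if "x \<le> x'" "x' \<le> z" for x x' z
    using P0.smult_assoc[of "?E x x'" "?E x' z" q] that q(1) by (simp add: incidence_basis_mult)
  have \<pi>_basis: "\<pi> (?E bt z \<odot>\<^bsub>P 0\<^esub> q) = (if z \<le> y then t (point_mass z) else \<zero>\<^bsub>I 1\<^esub>)" for z
    using module_homs_smult[OF \<pi> incidence_basis_closed[OF bot] q(1)] by (simp add: q(2) t_basis)
  \<comment> \<open>The module \<open>?Y\<close> has no component at \<open>x\<close>, so the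
    component of \<open>q\<close> at \<open>x\<close> is killed by \<open>\<pi>\<close> and comes
    from \<open>P 1\<close>. Injectivity of \<open>\<delta> 0\<close> pulls the relation with the
    idempotent back as well.\<close>
  have lift: "\<exists>u. u \<in> carrier (P 1) \<and> ?E x x \<odot>\<^bsub>P 1\<^esub> u = u \<and> \<delta> 0 u = ?E bt x \<odot>\<^bsub>P 0\<^esub> q" if x: "\<not> x \<le> y" for x
  proof -
    have "?E bt x \<odot>\<^bsub>P 0\<^esub> q \<in> module_kernel (P 0) (I 1) \<pi>"
      using x q(1) bot by (auto simp: module_kernel_def \<pi>_basis)
    then obtain u where u: "u \<in> carrier (P 1)" "\<delta> 0 u = ?E bt x \<odot>\<^bsub>P 0\<^esub> q"
      unfolding \<delta>_img[symmetric] by auto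
    have "\<delta> 0 (?E x x \<odot>\<^bsub>P 1\<^esub> u) = \<delta> 0 u"
      using module_homs_smult[OF \<delta> incidence_basis_closed[OF order_refl] u(1)] u(2) E_E[OF bot order_refl]
      by simp
    then have "?E x x \<odot>\<^bsub>P 1\<^esub> u = u"
      by (rule inj_\<delta>[OF P1.smult_closed[OF incidence_basis_closed[OF order_refl] u(1)] u(1)])
    with u show ?thesis by blast
  qed
  obtain u where u: "u \<in> carrier (P 1)" "?E a a \<odot>\<^bsub>P 1\<^esub> u = u" "\<delta> 0 u = ?E bt a \<odot>\<^bsub>P 0\<^esub> q"
    using lift[OF a] by blast
  obtain v where v: "v \<in> carrier (P 1)" "?E b b \<odot>\<^bsub>P 1\<^esub> v = v" "\<delta> 0 v = ?E bt b \<odot>\<^bsub>P 0\<^esub> q"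
    using lift[OF b] by blast
  \<comment> \<open>Both sides are the component \<open>(bt, tp)\<close> of \<open>q\<close>: the
    paths through \<open>a\<close> and through \<open>b\<close> compose to the same basis
    element.\<close>
  have "\<delta> 0 (?E a tp \<odot>\<^bsub>P 1\<^esub> u) = \<delta> 0 (?E b tp \<odot>\<^bsub>P 1\<^esub> v)"
    using module_homs_smult[OF \<delta> incidence_basis_closed[OF top] u(1)]
      module_homs_smult[OF \<delta> incidence_basis_closed[OF top] v(1)]
    by (simp add: u(3) v(3) E_E bot top)
  then have uv: "?E a tp \<odot>\<^bsub>P 1\<^esub> u = ?E b tp \<odot>\<^bsub>P 1\<^esub> v"
    by (rule inj_\<delta>[OF P1.smult_closed[OF incidence_basis_closed[OF top] u(1)]
          P1.smult_closed[OF incidence_basis_closed[OF top] v(1)]])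
  define c where "c = inf a b"
  have ca: "c \<le> a"
    by (simp add: c_def)
  obtain k where k: "k \<in> carrier (P 1)" "?E c c \<odot>\<^bsub>P 1\<^esub> k = k" "?E c a \<odot>\<^bsub>P 1\<^esub> k = u"
    using projective_incidence_module_amalgam[OF proj top top u(1,2) v(1) uv] unfolding c_def by metis
  \<comment> \<open>Both elements live at \<open>c\<close> and agree after moving up to
    \<open>a\<close>, and structure maps of the projective module \<open>P 0\<close> are
    injective.\<close>
  have "?E bt c \<odot>\<^bsub>P 0\<^esub> q = \<delta> 0 k"
  proof (rule projective_incidence_module_eqI[OF proj ca])
    show "?E bt c \<odot>\<^bsub>P 0\<^esub> q \<in> carrier (P 0)"
      using q(1) bot by simp
    show "?E c c \<odot>\<^bsub>P 0\<^esub> (?E bt c \<odot>\<^bsub>P 0\<^esub> q) = ?E bt c \<odot>\<^bsub>P 0\<^esub> q"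
      by (rule E_E[OF bot order_refl])
    show "\<delta> 0 k \<in> carrier (P 0)"
      by (rule module_homs_closed[OF \<delta> k(1)])
    show "?E c c \<odot>\<^bsub>P 0\<^esub> \<delta> 0 k = \<delta> 0 k"
      using module_homs_smult[OF \<delta> incidence_basis_closed[OF order_refl] k(1)] k(2) by metis
    show "?E c a \<odot>\<^bsub>P 0\<^esub> (?E bt c \<odot>\<^bsub>P 0\<^esub> q) = ?E c a \<odot>\<^bsub>P 0\<^esub> \<delta> 0 k"
      using module_homs_smult[OF \<delta> incidence_basis_closed[OF ca] k(1)] k(3) u(3) E_E[OF bot ca] by simp
  qed
  then have "?E bt c \<odot>\<^bsub>P 0\<^esub> q \<in> module_kernel (P 0) (I 1) \<pi>"
    using \<delta>_img k(1) by auto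
  then have tc: "t (point_mass c) = \<zero>\<^bsub>I 1\<^esub>"
    using ab by (simp add: module_kernel_def \<pi>_basis c_def)
  have cy: "?E c y \<in> carrier ?A" "point_mass c \<in> carrier ?Y"
    using ab bot by (auto simp: c_def)
  \<comment> \<open>Since \<open>c \<le> y\<close>, moving from \<open>c\<close> to \<open>y\<close>
    inside \<open>?Y\<close> reaches the socle generator, whose image \<open>s\<close> is nonzero;
    but the image at \<open>c\<close> has just been shown to vanish.\<close>
  have "s = t (?E c y \<odot>\<^bsub>?Y\<^esub> point_mass c)"
    unfolding basis_smult_point_mass by (simp add: ts)
  also have "\<dots> = ?E c y \<odot>\<^bsub>I 1\<^esub> \<zero>\<^bsub>I 1\<^esub>"
    using module_homs_smult[OF t cy] tc by simp
  also have "\<dots> = \<zero>\<^bsub>I 1\<^esub>"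
    by (rule I.smult_zero_right[OF cy(1)])
  finally show False
    using s(2) by simp
qed

text \<open>If the distributive law failed, some \<open>p\<close> would be maximal among the
  elements above its smaller side and not above its larger side. Such a \<open>p\<close> has a
  unique upper cover, so it is meet-prime, and \<open>inf y z \<le> p\<close> puts
  \<open>sup x y\<close> or \<open>sup x z\<close> below \<open>p\<close>. Then the larger side is
  below \<open>p\<close> too. Taking the join with \<open>p\<close> as its cover turns this into a
  contradiction.\<close>

lemma distrib_lattice_if_meet_prime:
  assumes prime: "\<And>y y' a b :: 'a::{finite,lattice}. y < y' \<Longrightarrow> (\<And>z. y < z \<Longrightarrow> y' \<le> z) \<Longrightarrow> inf a b \<le> y \<Longrightarrow>
      a \<le> y \<or> b \<le> y"
  shows "class.distrib_lattice (inf :: 'a \<Rightarrow> 'a \<Rightarrow> 'a) (\<le>) (<) sup"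
proof
  fix x y z :: 'a
  let ?v = "sup x (inf y z)" and ?w = "inf (sup x y) (sup x z)"
  have "?w \<le> ?v"
  proof (rule ccontr)
    assume "\<not> ?w \<le> ?v"
    define S where "S = {p. ?v \<le> p \<and> \<not> ?w \<le> p}"
    have "?v \<in> S"
      using \<open>\<not> ?w \<le> ?v\<close> by (simp add: S_def)
    then have "\<exists>p\<in>S. ?v \<le> p \<and> (\<forall>r\<in>S. p \<le> r \<longrightarrow> p = r)"
      by (rule finite_has_maximal2[OF finite])
    then obtain p where "p \<in> S" and p_max: "\<And>r. r \<in> S \<Longrightarrow> p \<le> r \<Longrightarrow> p = r"
      by blast
    then have p: "?v \<le> p" "\<not> ?w \<le> p"
      by (auto simp: S_def)
    have max: "?w \<le> r" if "p < r" for r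
    proof (rule ccontr)
      assume "\<not> ?w \<le> r"
      moreover have "?v \<le> r"
        using p(1) that by (meson order.strict_implies_order order_trans)
      ultimately have "p = r"
        using p_max[of r] that by (simp add: S_def order.strict_implies_order)
      with that show False by simp
    qed
    \<comment> \<open>By maximality everything strictly above \<open>p\<close> is above
      \<open>?w\<close>, so \<open>sup p ?w\<close> is the unique upper cover of
      \<open>p\<close>.\<close>
    have "p < sup p ?w"
      using p(2) by (metis sup.order_iff sup_ge1 order.not_eq_order_implies_strict sup_commute)
    moreover have "sup p ?w \<le> r" if "p < r" for r
      using max[OF that] that by simp
    moreover have "inf y z \<le> p"
      using p(1) by simp
    ultimately have "y \<le> p \<or> z \<le> p"
      by (rule prime)
    \<comment> \<open>\<open>x\<close> is below \<open>?v\<close> and hence below \<open>p\<close>.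
      Either alternative yields \<open>?w \<le> p\<close>, against the choice of
      \<open>p\<close>.\<close>
    then have "sup x y \<le> p \<or> sup x z \<le> p"
      using p(1) by auto
    then show False
      using p(2) by (meson inf_le1 inf_le2 order_trans)
  qed
  \<comment> \<open>The other inequality holds in every lattice.\<close>
  then show "?v = ?w"
    by (intro order.antisym) (auto intro: le_infI1 le_infI2)
qed

theorem theorem0p5:
  assumes "auslander_gorenstein
             (incidence_algebra :: ('k::field, 'a::{finite,lattice} \<times> 'a \<Rightarrow> 'k) module)"
  shows "class.distrib_lattice (inf :: 'a \<Rightarrow> 'a \<Rightarrow> 'a) (\<le>) (<) sup"
proof (rule distrib_lattice_if_meet_prime)
  have "auslander_condition (incidence_algebra :: ('k, 'a \<times> 'a \<Rightarrow> 'k) module)"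
    using assms by (simp add: auslander_gorenstein_def)
  then show "a \<le> y \<or> b \<le> y"
    if "y < y'" "\<And>z. y < z \<Longrightarrow> y' \<le> z" "inf a b \<le> y" for y y' a b :: 'a
    using that by (rule auslander_condition_imp_meet_prime)
qed

end
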